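(* There is no correct procedure; that is, there do not exist a finite alphabet $\Sigma$, a countable set $L$ of analytic functions on $I=[0,2\pi]$, and functions $M$ and $G$ such that the procedure $\mathfrak{T}$ determined by $(\Sigma,L,M,G)$ as described in the context is correct. In other words, there is no correct procedure to determine with finitely many iterations whether the curve associated to an analytic curvature function $k$ on $I$ is closed by computing finitely many evaluations and/or generalized level sets of $k$, its derivatives and its antiderivatives.
   Context: Curves. $I=[0,2\pi]$ and $\mathbb{R}^2$ is identified with $\mathbb{C}$. The curve associated to a continuous curvature function $k:I\to\mathbb{R}$ is $\gamma(t)=\int_0^t\mathrm{e}^{i\theta(s)}\,\mathrm{d}s$, where $\theta(t)=\int_0^t k(s)\,\mathrm{d}s$ (unique up to rigid motions); it is closed if $\gamma(0)=\gamma(2\pi)$. "Analytic on $I$" means real-valued and real-analytic on $I$. For an analytic $k$ and $n\in\mathbb{Z}$, $k^{(n)}$ denotes the $n$-th derivative of $k$ if $n>0$, $k$ itself if $n=0$, and, if $n<0$, the result of applying $-n$ times the operation $u\mapsto\int_0^t u(s)\,\mathrm{d}s$ to $k$. Data of a procedure. $\Sigma$ is a finite alphabet of symbols containing a blank symbol $\square$ and two further special symbols, one meaning "no solutions" and one meaning "the two functions coincide". $A$ is the set of all sequences $\{a_j\}_{j\in\mathbb{N}}$ with $a_j\in\mathbb{R}\cup\Sigma$. $L=\{l_j\}_{j\geq1}$ is a fixed countable set of analytic functions on $I$. $C$ is the set of real sequences $\{c_j\}_{j\in\mathbb{N}_0}$ with $c_j=0$ for all $j$ big enough and $c_0\in I$.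 The symbols $E$ and $\cap$ are two formal labels. A procedure is given by arbitrary functions $$M: A\to\{E,\cap\}\times\mathbb{Z}\times C,\qquad G: A\times\{E,\cap\}\times\mathbb{Z}\times A\to\{\mathrm{YES},\mathrm{NO}\}\cup A.$$ These do not depend on the input $k$. Access to the input. For each analytic $k$ on $I$, the function $H_k:\{E,\cap\}\times\mathbb{Z}\times C\to\{E,\cap\}\times\mathbb{Z}\times A$ is defined by $H_k(\sigma,n,\{c_j\})=(\sigma,n,\{a_j\})$, where: if $\sigma=E$, the sequence $\{a_j\}$ stores the value $k^{(n)}(c_0)$; if $\sigma=\cap$, it stores the solutions in $I$ of the equation $k^{(n)}=\sum_{j\geq1}c_jl_j$. Storing means writing the value, respectively the solutions sequentially (in increasing order), in the first terms of the sequence if solutions exist and are finitely many; if there are no solutions, or if the two functions coincide on $I$, the corresponding special symbol is written instead (by analyticity there are no other possibilities). All unused terms are filled with $\square$. Running the procedure. On input $k$, start with the sequence $\{a_j\}\in A$ with $a_j=\square$ for all $j$. At each iteration compute $G\bigl(\{a_j\},H_k(M(\{a_j\}))\bigr)$. If the result is YES or NO, stop and output it; otherwise the result is an element of $A$, which replaces the current sequence $\{a_j\}$, and the iteration is repeated. The output, when the run stops, is denoted $\mathfrak{T}(k)$. Correctness. The procedure $\mathfrak{T}$ is correct if for every analytic function $k$ on $I$ it outputs an answer $\mathfrak{T}(k)\in\{\mathrm{YES},\mathrm{NO}\}$ after finitely many iterations, and $\mathfrak{T}(k)=\mathrm{YES}$ if and only if the arc-length parametrized curve with curvature $k$ is closed.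 *)

theory Defs
  imports "HOL-Analysis.Analysis"
begin

abbreviation I :: "real set" where
  "I \<equiv> {0..2 * pi}"

text \<open>At the end points of the interval the expansion is required on one side only; its power series
  then provides an analytic extension to a neighbourhood, so this is the usual notion of
  analyticity on a closed interval. Inputs are functions on all of \<^typ>\<open>real\<close>, but nothing below
  depends on their values outside \<^term>\<open>I\<close>.\<close>

definition analytic_on_I :: "(real \<Rightarrow> real) \<Rightarrow> bool" where
  "analytic_on_I f \<longleftrightarrow>
     (\<forall>x\<in>I. \<exists>r>0. \<exists>a :: nat \<Rightarrow> real. \<forall>y\<in>I. \<bar>y - x\<bar> < r \<longrightarrow> (\<lambda>n. a n * (y - x) ^ n) sums f y)"

definition derivative_on_I :: "(real \<Rightarrow> real) \<Rightarrow> real \<Rightarrow> real" where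
  "derivative_on_I u t = vector_derivative u (at t within I)"

definition antiderivative :: "(real \<Rightarrow> real) \<Rightarrow> real \<Rightarrow> real" where
  "antiderivative u t = integral {0..t} u"

definition iterated :: "int \<Rightarrow> (real \<Rightarrow> real) \<Rightarrow> real \<Rightarrow> real" where
  "iterated n k =
     (if n \<ge> 0 then (derivative_on_I ^^ nat n) k else (antiderivative ^^ nat (- n)) k)"

definition curve :: "(real \<Rightarrow> real) \<Rightarrow> real \<Rightarrow> complex" where
  "curve k t = integral {0..t} (\<lambda>s. exp (\<i> * complex_of_real (integral {0..s} k)))"

definition closed_curve :: "(real \<Rightarrow> real) \<Rightarrow> bool" where
  "closed_curve k \<longleftrightarrow> curve k 0 = curve k (2 * pi)"

text \<open>\<open>Ev\<close> and \<open>Cap\<close> are the labels $E$ and $\cap$. The alphabet is the finite type \<^typ>\<open>'s\<close>, and the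
  terms of the sequences in $A$ are indexed from \<open>0\<close>.\<close>

datatype label = Ev | Cap

datatype answer = YES | NO

type_synonym 's tape = "nat \<Rightarrow> real + 's"

definition coeffs_C :: "(nat \<Rightarrow> real) set" where
  "coeffs_C = {c. c 0 \<in> I \<and> (\<forall>\<^sub>F j in sequentially. c j = 0)}"

definition store :: "'s \<Rightarrow> (real + 's) list \<Rightarrow> 's tape" where
  "store blank xs = (\<lambda>j. if j < length xs then xs ! j else Inr blank)"

definition combination :: "(nat \<Rightarrow> real \<Rightarrow> real) \<Rightarrow> (nat \<Rightarrow> real) \<Rightarrow> real \<Rightarrow> real" where
  "combination l c t = (\<Sum>j | j \<ge> 1 \<and> c j \<noteq> 0. c j * l j t)"

definition solutions :: "(real \<Rightarrow> real) \<Rightarrow> (real \<Rightarrow> real) \<Rightarrow> real set" where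
  "solutions f g = {t \<in> I. f t = g t}"

text \<open>For analytic functions the set of solutions is finite in the last case of \<open>level_set\<close>, so
  \<^const>\<open>sorted_list_of_set\<close> lists all its elements in increasing order.\<close>

definition level_set ::
  "'s \<Rightarrow> 's \<Rightarrow> 's \<Rightarrow> (real \<Rightarrow> real) \<Rightarrow> (real \<Rightarrow> real) \<Rightarrow> 's tape" where
  "level_set blank no_sol coincide f g =
     store blank
       (if solutions f g = I then [Inr coincide]
        else if solutions f g = {} then [Inr no_sol]
        else map Inl (sorted_list_of_set (solutions f g)))"

fun access :: "'s \<Rightarrow> 's \<Rightarrow> 's \<Rightarrow> (nat \<Rightarrow> real \<Rightarrow> real) \<Rightarrow> (real \<Rightarrow> real) \<Rightarrow>
    label \<times> int \<times> (nat \<Rightarrow> real) \<Rightarrow> label \<times> int \<times> 's tape" where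
  "access blank no_sol coincide l k (Ev, n, c) =
     (Ev, n, store blank [Inl (iterated n k (c 0))])"
| "access blank no_sol coincide l k (Cap, n, c) =
     (Cap, n, level_set blank no_sol coincide (iterated n k) (combination l c))"

text \<open>\<open>run_output H M G a v\<close>: started on the sequence \<open>a\<close>, the procedure stops after finitely many
  iterations with output \<open>v\<close>.\<close>

inductive run_output ::
  "(label \<times> int \<times> (nat \<Rightarrow> real) \<Rightarrow> label \<times> int \<times> 's tape) \<Rightarrow>
   ('s tape \<Rightarrow> label \<times> int \<times> (nat \<Rightarrow> real)) \<Rightarrow>
   ('s tape \<times> label \<times> int \<times> 's tape \<Rightarrow> answer + 's tape) \<Rightarrow>
   's tape \<Rightarrow> answer \<Rightarrow> bool"
  for H M G where
  stop: "G (a, H (M a)) = Inl v \<Longrightarrow> run_output H M G a v"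
| continue: "G (a, H (M a)) = Inr a' \<Longrightarrow> run_output H M G a' v \<Longrightarrow> run_output H M G a v"

definition correct_procedure ::
  "'s \<Rightarrow> 's \<Rightarrow> 's \<Rightarrow> (nat \<Rightarrow> real \<Rightarrow> real) \<Rightarrow>
   ('s tape \<Rightarrow> label \<times> int \<times> (nat \<Rightarrow> real)) \<Rightarrow>
   ('s tape \<times> label \<times> int \<times> 's tape \<Rightarrow> answer + 's tape) \<Rightarrow> bool" where
  "correct_procedure blank no_sol coincide l M G \<longleftrightarrow>
     (\<forall>k. analytic_on_I k \<longrightarrow>
        (\<exists>v. run_output (access blank no_sol coincide l k) M G (\<lambda>_. Inr blank) v \<and>
             (v = YES \<longleftrightarrow> closed_curve k)))"

end

theory Submission
  imports Defs "HOL-Complex_Analysis.Complex_Analysis" "HOL-Library.Function_Algebras"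
begin

text \<open>A curve whose curvature is queried finitely often can be opened without changing any answer. A run
  on an input \<open>k\<close> that outputs \<^const>\<open>YES\<close> involves finitely many queries
  (\<open>run_output_finite_queries\<close>), so it suffices to find an analytic \<open>k'\<close> with the same answers to these
  whose curve is not closed: the run on \<open>k'\<close> is then the same and outputs \<^const>\<open>YES\<close> wrongly.

  An answer to a level set query is rigid only when it says that the two functions coincide, since
  this prescribes \<open>k\<close> up to a polynomial. The starting curve is therefore chosen such that this never
  happens. The closed curves with curvature \<open>sym_curvature s\<close>, \<open>s > 0\<close>, form an uncountable family whose
  derivatives, or antiderivatives, of any fixed order are linearly independent, whereas for each order the
  functions that coincide with a combination of the \<open>l j\<close> lie in a countable union of
  finite-dimensional spaces. Some parameter \<open>s\<close> avoids all of them (\<open>generic_parameter\<close>).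

  For this curve each level set is finite. The curvature is perturbed by \<open>\<epsilon>\<close> times a high derivative
  of a function that vanishes to high order at \<open>0\<close> and \<open>2 * pi\<close>, at all evaluation points, and at all
  points of the level sets. The values at these points do not change, and for small
  \<open>\<epsilon>\<close> no new solution appears, because near a zero of finite order a function dominates every other
  one that vanishes there to higher order (\<open>analytic_on_I_Lojasiewicz\<close>). This leaves enough freedom to make
  the first variation of the end point of the curve nonzero (\<open>undetectable_opening\<close>).\<close>

section \<open>Real entire functions\<close>

text \<open>The perturbations below are real functions that have to be differentiated and integrated
  arbitrarily often, multiplied, and composed with \<^const>\<open>exp\<close>, \<^const>\<open>sin\<close> and \<^const>\<open>cos\<close>. With a complex
  extension required on the whole plane, all these closure properties come from complex analysis and
  no radius of convergence has to be tracked.\<close>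

definition real_entire :: "(real \<Rightarrow> real) \<Rightarrow> bool" where
  "real_entire f \<longleftrightarrow>
     (\<exists>F. F holomorphic_on UNIV \<and> (\<forall>t. F (complex_of_real t) = complex_of_real (f t)))"

lemma real_entireI:
  "F holomorphic_on UNIV \<Longrightarrow> (\<And>t. F (complex_of_real t) = complex_of_real (f t)) \<Longrightarrow> real_entire f"
  unfolding real_entire_def by blast

lemma real_entire_const: "real_entire (\<lambda>t. c)"
  by (rule real_entireI[of "\<lambda>_. of_real c"]) auto

lemma real_entire_id: "real_entire (\<lambda>t. t)"
  by (rule real_entireI[of "\<lambda>z. z"]) auto

lemma real_entire_add:
  assumes "real_entire f" "real_entire g" shows "real_entire (\<lambda>t. f t + g t)"
proof -
  obtain F G where "F holomorphic_on UNIV" "\<And>t. F (complex_of_real t) = of_real (f t)"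
    "G holomorphic_on UNIV" "\<And>t. G (complex_of_real t) = of_real (g t)"
    using assms by (metis real_entire_def)
  then show ?thesis
    by (intro real_entireI[of "\<lambda>z. F z + G z"]) (auto intro!: holomorphic_intros)
qed

lemma real_entire_mult:
  assumes "real_entire f" "real_entire g" shows "real_entire (\<lambda>t. f t * g t)"
proof -
  obtain F G where "F holomorphic_on UNIV" "\<And>t. F (complex_of_real t) = of_real (f t)"
    "G holomorphic_on UNIV" "\<And>t. G (complex_of_real t) = of_real (g t)"
    using assms by (metis real_entire_def)
  then show ?thesis
    by (intro real_entireI[of "\<lambda>z. F z * G z"]) (auto intro!: holomorphic_intros)
qed

lemma real_entire_diff:
  assumes "real_entire f" "real_entire g" shows "real_entire (\<lambda>t. f t - g t)"
  using real_entire_add[OF assms(1) real_entire_mult[OF real_entire_const[of "-1"] assms(2)]] by simp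

lemma real_entire_power: "real_entire f \<Longrightarrow> real_entire (\<lambda>t. f t ^ n)"
  by (induction n) (auto intro: real_entire_const real_entire_mult)

lemma real_entire_prod:
  "(\<And>i. i \<in> A \<Longrightarrow> real_entire (f i)) \<Longrightarrow> real_entire (\<lambda>t. \<Prod>i\<in>A. f i t)"
  by (induction A rule: infinite_finite_induct) (auto intro: real_entire_const real_entire_mult)

lemma real_entire_compose:
  assumes "G holomorphic_on UNIV" "\<And>t. G (complex_of_real t) = complex_of_real (g t)" "real_entire f"
  shows "real_entire (\<lambda>t. g (f t))"
proof -
  obtain F where "F holomorphic_on UNIV" "\<And>t. F (complex_of_real t) = of_real (f t)"
    using assms(3) by (metis real_entire_def)
  then show ?thesis
    using assms(1,2) holomorphic_on_compose[of F UNIV G]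
    by (intro real_entireI[of "G \<circ> F"]) (auto intro: holomorphic_on_subset)
qed

lemma real_entire_exp: "real_entire f \<Longrightarrow> real_entire (\<lambda>t. exp (f t))"
  by (rule real_entire_compose[of exp]) (auto intro!: holomorphic_intros simp: exp_of_real)

lemma real_entire_sin: "real_entire f \<Longrightarrow> real_entire (\<lambda>t. sin (f t))"
  by (rule real_entire_compose[of sin]) (auto intro!: holomorphic_intros simp: sin_of_real)

lemma real_entire_cos: "real_entire f \<Longrightarrow> real_entire (\<lambda>t. cos (f t))"
  by (rule real_entire_compose[of cos]) (auto intro!: holomorphic_intros simp: cos_of_real)

lemmas real_entire_intros = real_entire_const real_entire_id real_entire_add real_entire_diff
  real_entire_mult real_entire_power real_entire_prod real_entire_exp real_entire_sin real_entire_cos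

text \<open>Along the real axis the extension takes real values, so its derivative there is real as well.\<close>

lemma has_real_derivative_restriction:
  assumes "(F has_field_derivative F') (at (complex_of_real t))"
    and "\<And>t. F (complex_of_real t) = complex_of_real (f t)"
  shows "(f has_real_derivative Re F') (at t)" "F' = complex_of_real (Re F')"
proof -
  have v: "((\<lambda>t. complex_of_real (f t)) has_vector_derivative F') (at t)"
    using has_vector_derivative_real_field[OF assms(1), of UNIV] by (simp add: assms(2))
  show "(f has_real_derivative Re F') (at t)"
    using bounded_linear.has_vector_derivative[OF bounded_linear_Re v]
    by (simp add: has_real_derivative_iff_has_vector_derivative)
  have "((\<lambda>t. 0) has_vector_derivative Im F') (at t)"
    using bounded_linear.has_vector_derivative[OF bounded_linear_Im v] by simp
  then have "Im F' = 0"
    by (metis has_vector_derivative_const vector_derivative_unique_at)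
  then show "F' = complex_of_real (Re F')" by (simp add: complex_eq_iff)
qed

lemma real_entire_deriv:
  assumes "real_entire f"
  shows "real_entire (deriv f)" "(f has_real_derivative deriv f t) (at t)"
proof -
  obtain F where F: "F holomorphic_on UNIV" "\<And>t. F (complex_of_real t) = of_real (f t)"
    using assms by (metis real_entire_def)
  have d: "(F has_field_derivative deriv F z) (at z)" for z
    using F(1) holomorphic_derivI by blast
  note * = has_real_derivative_restriction[OF d F(2)]
  show "(f has_real_derivative deriv f t) (at t)" 
    using *(1) DERIV_imp_deriv by metis
  show "real_entire (deriv f)"
  proof (rule real_entireI[of "deriv F"])
    show "deriv F holomorphic_on UNIV" by (intro holomorphic_deriv F) auto
    show "deriv F (complex_of_real t) = of_real (deriv f t)" for t
      using * DERIV_imp_deriv by metis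
  qed
qed

lemma real_entire_funpow_deriv: "real_entire f \<Longrightarrow> real_entire ((deriv ^^ n) f)"
  by (induction n) (simp_all add: real_entire_deriv(1))

lemma real_entire_continuous: "real_entire f \<Longrightarrow> continuous_on S f"
  by (intro continuous_at_imp_continuous_on ballI DERIV_isCont[OF real_entire_deriv(2)])

text \<open>A primitive on the plane has constant imaginary part along the real axis, because its derivative
  is real there; normalizing it to vanish at \<open>0\<close> makes it real.\<close>

lemma real_entire_primitive:
  assumes "real_entire f"
  obtains g where "real_entire g" "\<And>t. (g has_real_derivative f t) (at t)" "g 0 = 0"
proof -
  obtain F where F: "F holomorphic_on UNIV" "\<And>t. F (complex_of_real t) = of_real (f t)"
    using assms by (metis real_entire_def)
  obtain G0 where G0: "\<And>z. (G0 has_field_derivative F z) (at z)"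
    using holomorphic_convex_primitive'[OF convex_UNIV open_UNIV F(1)] by auto
  define G where "G z = G0 z - G0 0" for z
  have G: "(G has_field_derivative F z) (at z)" for z
    unfolding G_def using G0[of z] by (auto intro!: derivative_eq_intros)
  have v: "((\<lambda>t. G (of_real t)) has_vector_derivative complex_of_real (f t)) (at t)" for t
    using has_vector_derivative_real_field[OF G, of t UNIV] by (simp add: F(2))
  have "((\<lambda>t. Im (G (of_real t))) has_real_derivative 0) (at t)" for t
    using bounded_linear.has_vector_derivative[OF bounded_linear_Im v]
    by (simp add: has_real_derivative_iff_has_vector_derivative)
  then have "Im (G (of_real t)) = Im (G (of_real 0))" for t
    using DERIV_const_ratio_const2 DERIV_isconst_all by blast
  then have real: "G (of_real t) = of_real (Re (G (of_real t)))" for t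
    by (simp add: complex_eq_iff G_def)
  show ?thesis
  proof
    show "real_entire (\<lambda>t. Re (G (of_real t)))"
      by (rule real_entireI[of G, OF _ real]) (use G holomorphic_on_open in blast)
    show "((\<lambda>t. Re (G (of_real t))) has_real_derivative f t) (at t)" for t
      using bounded_linear.has_vector_derivative[OF bounded_linear_Re v]
      by (simp add: has_real_derivative_iff_has_vector_derivative)
  qed (simp add: G_def)
qed

lemma real_entire_analytic_on_I:
  assumes "real_entire f" shows "analytic_on_I f"
  unfolding analytic_on_I_def
proof
  fix x
  obtain F where F: "F holomorphic_on UNIV" "\<And>t. F (complex_of_real t) = of_real (f t)"
    using assms by (metis real_entire_def)
  define c where "c n = (deriv ^^ n) F (of_real x) / fact n" for n
  have "(\<lambda>n. Re (c n) * (y - x) ^ n) sums f y" for y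
  proof -
    have "(\<lambda>n. c n * (complex_of_real y - of_real x) ^ n) sums F (of_real y)"
      unfolding c_def
      by (rule holomorphic_power_series[of _ _ "\<bar>y - x\<bar> + 1"])
        (auto intro: holomorphic_on_subset[OF F(1)] simp: dist_real_def dist_norm norm_of_real simp flip: of_real_diff)
    from sums_Re[OF this] show ?thesis
      by (simp add: F(2) flip: of_real_diff of_real_power)
  qed
  then show "\<exists>r>0. \<exists>a :: nat \<Rightarrow> real. \<forall>y\<in>I. \<bar>y - x\<bar> < r \<longrightarrow> (\<lambda>n. a n * (y - x) ^ n) sums f y"
    by (meson zero_less_one)
qed

section \<open>Zeros of analytic functions on the interval\<close>

lemma analytic_on_IE:
  assumes "analytic_on_I f" "x \<in> I"
  obtains r a where "r > 0"
    "\<And>y. y \<in> I \<Longrightarrow> \<bar>y - x\<bar> < r \<Longrightarrow> (\<lambda>n. a n * (y - x) ^ n) sums f y"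
proof -
  have "\<exists>r>0. \<exists>a :: nat \<Rightarrow> real. \<forall>y\<in>I. \<bar>y - x\<bar> < r \<longrightarrow> (\<lambda>n. a n * (y - x) ^ n) sums f y"
    using assms unfolding analytic_on_I_def by (rule bspec)
  then show ?thesis using that by blast
qed

lemma analytic_on_I_add:
  assumes "analytic_on_I f" "analytic_on_I g" shows "analytic_on_I (\<lambda>t. f t + g t)"
  unfolding analytic_on_I_def
proof
  fix x assume x: "x \<in> I"
  obtain r a where r: "r > 0"
    and a: "\<And>y. y \<in> I \<Longrightarrow> \<bar>y - x\<bar> < r \<Longrightarrow> (\<lambda>n. a n * (y - x) ^ n) sums f y"
    using analytic_on_IE[OF assms(1) x] by blast
  obtain s b where s: "s > 0"
    and b: "\<And>y. y \<in> I \<Longrightarrow> \<bar>y - x\<bar> < s \<Longrightarrow> (\<lambda>n. b n * (y - x) ^ n) sums g y"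
    using analytic_on_IE[OF assms(2) x] by blast
  have "(\<lambda>n. (a n + b n) * (y - x) ^ n) sums (f y + g y)" if "y \<in> I" "\<bar>y - x\<bar> < min r s" for y
    using sums_add[OF a b, of y y] that by (simp add: distrib_right)
  moreover have "min r s > 0" using r s by simp
  ultimately
  show "\<exists>r>0. \<exists>a :: nat \<Rightarrow> real. \<forall>y\<in>I. \<bar>y - x\<bar> < r \<longrightarrow> (\<lambda>n. a n * (y - x) ^ n) sums (f y + g y)"
    by (intro exI[of _ "min r s"] exI[of _ "\<lambda>n. a n + b n"] conjI ballI impI)
qed

lemma analytic_on_I_scale:
  assumes "analytic_on_I f" shows "analytic_on_I (\<lambda>t. c * f t)"
  unfolding analytic_on_I_def
proof
  fix x assume x: "x \<in> I"
  obtain r a where r: "r > 0"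
    and a: "\<And>y. y \<in> I \<Longrightarrow> \<bar>y - x\<bar> < r \<Longrightarrow> (\<lambda>n. a n * (y - x) ^ n) sums f y"
    using analytic_on_IE[OF assms x] by blast
  have "(\<lambda>n. (c * a n) * (y - x) ^ n) sums (c * f y)" if "y \<in> I" "\<bar>y - x\<bar> < r" for y
    using sums_mult[OF a, of y c] that by (simp add: mult.assoc)
  with r
  show "\<exists>r>0. \<exists>a :: nat \<Rightarrow> real. \<forall>y\<in>I. \<bar>y - x\<bar> < r \<longrightarrow> (\<lambda>n. a n * (y - x) ^ n) sums (c * f y)"
    by (intro exI[of _ r] exI[of _ "\<lambda>n. c * a n"] conjI ballI impI)
qed

lemma analytic_on_I_sum:
  "(\<And>i. i \<in> A \<Longrightarrow> analytic_on_I (f i)) \<Longrightarrow> analytic_on_I (\<lambda>t. \<Sum>i\<in>A. f i t)"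
  by (induction A rule: infinite_finite_induct)
    (auto intro: analytic_on_I_add real_entire_analytic_on_I real_entire_const)

lemma analytic_on_I_combination:
  "(\<forall>j\<ge>1. analytic_on_I (l j)) \<Longrightarrow> analytic_on_I (combination l c)"
  unfolding combination_def[abs_def] by (intro analytic_on_I_sum analytic_on_I_scale) auto

lemma near_point_in_I:
  assumes "x \<in> I" "r > 0" obtains y where "y \<in> I" "y \<noteq> x" "\<bar>y - x\<bar> < r"
proof -
  have "pi > 0" by simp
  then show ?thesis
    using assms that[of "if x \<le> pi then x + min (r / 2) pi else x - min (r / 2) pi"]
    by (auto simp: min_def abs_if split: if_splits)
qed

text \<open>Either all coefficients of the expansion at \<open>x\<close> vanish, or the first nonzero one, of index \<open>N\<close>,
  dominates the rest near \<open>x\<close>. That \<open>N\<close> is \<open>0\<close> unless \<open>f x = 0\<close> is recorded because the lower bound is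
  later compared with weights that are small only near the zeros of \<open>f\<close>.\<close>

lemma analytic_on_I_local:
  assumes "analytic_on_I f" "x \<in> I"
  obtains (flat) \<delta> where "\<delta> > 0" "\<And>t. t \<in> I \<Longrightarrow> \<bar>t - x\<bar> < \<delta> \<Longrightarrow> f t = 0"
  | (order) \<delta> c N where "\<delta> > 0" "c > 0" "N = 0 \<or> f x = 0"
      "\<And>t. t \<in> I \<Longrightarrow> \<bar>t - x\<bar> < \<delta> \<Longrightarrow> c * \<bar>t - x\<bar> ^ N \<le> \<bar>f t\<bar>"
proof -
  obtain r a where r: "r > 0" and
    a: "\<And>y. y \<in> I \<Longrightarrow> \<bar>y - x\<bar> < r \<Longrightarrow> (\<lambda>n. a n * (y - x) ^ n) sums f y"
    using analytic_on_IE[OF assms] by blast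
  show ?thesis
  proof (cases "\<forall>n. a n = 0")
    case True
    have "f t = 0" if "t \<in> I" "\<bar>t - x\<bar> < r" for t
      using a[OF that] True by (simp add: sums_iff)
    then show ?thesis using flat r by blast
  next
    case False
    define N where "N = (LEAST n. a n \<noteq> 0)"
    have N: "a N \<noteq> 0" "\<And>n. n < N \<Longrightarrow> a n = 0"
      using False LeastI_ex[of "\<lambda>n. a n \<noteq> 0"] not_less_Least unfolding N_def by blast+
    \<comment> \<open>Convergence is known only at points of \<^term>\<open>I\<close>, possibly on one side of \<open>x\<close>;
      convergence at one \<open>y \<noteq> x\<close> already gives it on a two-sided neighbourhood.\<close>
    obtain y where y: "y \<in> I" "y \<noteq> x" "\<bar>y - x\<bar> < r"
      using near_point_in_I assms(2) r by blast
    define g where "g u = (\<Sum>n. a (n + N) * u ^ n)" for u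
    have "summable (\<lambda>n. a (n + N) * (y - x) ^ (n + N))"
      using sums_summable[OF a[OF y(1,3)]] by (simp add: summable_iff_shift[of "\<lambda>n. a n * (y - x) ^ n"])
    then have "summable (\<lambda>n. inverse ((y - x) ^ N) * (a (n + N) * (y - x) ^ (n + N)))"
      by (rule summable_mult)
    then have "summable (\<lambda>n. a (n + N) * (y - x) ^ n)"
      using y(2) by (simp add: power_add field_simps)
    then have "isCont g 0"
      unfolding g_def by (rule isCont_powser) (use y in auto)
    moreover have g0: "g 0 = a N"
      using sums_unique[OF powser_sums_zero[of "\<lambda>n. a (n + N)"]] by (simp add: g_def)
    ultimately have "\<forall>\<^sub>F u in at 0. dist (g u) (a N) < \<bar>a N\<bar> / 2"
      using N(1) unfolding isCont_def by (auto dest!: tendstoD[where e = "\<bar>a N\<bar> / 2"])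
    then obtain d where d: "d > 0" "\<And>u. u \<noteq> 0 \<Longrightarrow> \<bar>u\<bar> < d \<Longrightarrow> \<bar>g u - a N\<bar> < \<bar>a N\<bar> / 2"
      unfolding eventually_at dist_real_def by auto
    have low: "\<bar>a N\<bar> / 2 \<le> \<bar>g u\<bar>" if "\<bar>u\<bar> < d" for u
      using d(2)[of u] that g0 by (cases "u = 0") (auto simp: abs_if split: if_splits)
    show ?thesis
    proof (rule order)
      show "min d r > 0" "\<bar>a N\<bar> / 2 > 0" using d r N by auto
      have "f x = a 0" using a[OF assms(2)] r by simp
      then show "N = 0 \<or> f x = 0" using N(2) by auto
      fix t assume t: "t \<in> I" "\<bar>t - x\<bar> < min d r"
      have sums: "(\<lambda>n. a (n + N) * (t - x) ^ (n + N)) sums f t"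
        using a[of t] t N(2) sums_zero_iff_shift[of N "\<lambda>n. a n * (t - x) ^ n" "f t"] by simp
      then have "f t = (\<Sum>n. (t - x) ^ N * (a (n + N) * (t - x) ^ n))"
        by (simp add: sums_iff power_add mult_ac)
      also have "\<dots> = (t - x) ^ N * g (t - x)"
      proof (cases "t = x")
        case False
        have "summable (\<lambda>n. inverse ((t - x) ^ N) * (a (n + N) * (t - x) ^ (n + N)))"
          by (rule summable_mult[OF sums_summable[OF sums]])
        then have "summable (\<lambda>n. a (n + N) * (t - x) ^ n)"
          using False by (simp add: power_add field_simps)
        then show ?thesis unfolding g_def by (rule suminf_mult)
      next
        case True
        have "summable (\<lambda>n. a (n + N) * 0 ^ n)" by (rule summable_zero_power')
        then show ?thesis using True unfolding g_def by (subst suminf_mult) auto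
      qed
      finally show "\<bar>a N\<bar> / 2 * \<bar>t - x\<bar> ^ N \<le> \<bar>f t\<bar>"
        using low[of "t - x"] t mult_left_mono[of "\<bar>a N\<bar> / 2" "\<bar>g (t - x)\<bar>" "\<bar>t - x\<bar> ^ N"]
        by (simp add: abs_mult power_abs mult.commute)
    qed
  qed
qed

text \<open>The points near which \<open>f\<close> vanishes form an open and closed subset of \<^term>\<open>I\<close>: by the local
  dichotomy, such points do not accumulate at a point where \<open>f\<close> has finite order.\<close>

lemma analytic_on_I_identity:
  assumes f: "analytic_on_I f" and x: "x \<in> I" and d: "\<delta> > 0"
    and 0: "\<And>t. t \<in> I \<Longrightarrow> \<bar>t - x\<bar> < \<delta> \<Longrightarrow> f t = 0" and y: "y \<in> I"
  shows "f y = 0"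
proof -
  define P where "P x \<longleftrightarrow> (\<exists>\<delta>>0. \<forall>t\<in>I. \<bar>t - x\<bar> < \<delta> \<longrightarrow> f t = 0)" for x
  have "P y"
  proof (rule connected_induction_simple[of I x y])
    show "P x" using 0 d unfolding P_def by blast
    fix a assume a: "a \<in> I"
    have op: "openin (top_of_set I) (I \<inter> ball a \<delta>)" for \<delta>
      by (simp add: openin_open_Int)
    show "\<exists>T. openin (top_of_set I) T \<and> a \<in> T \<and> (\<forall>x\<in>T. \<forall>y\<in>T. P x \<longrightarrow> P y)"
      using f a
    proof (cases rule: analytic_on_I_local)
      case (flat \<delta>)
      have "P y" if "y \<in> I \<inter> ball a \<delta>" for y
        unfolding P_def using flat that
        by (intro exI[of _ "\<delta> - \<bar>y - a\<bar>"]) (auto simp: dist_real_def abs_minus_commute)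
      then show ?thesis using op a flat by (intro exI[of _ "I \<inter> ball a \<delta>"]) auto
    next
      case (order \<delta> c N)
      have "\<not> P y" if y: "y \<in> I \<inter> ball a \<delta>" for y
      proof
        assume "P y"
        then obtain e where e: "e > 0" "\<And>t. t \<in> I \<Longrightarrow> \<bar>t - y\<bar> < e \<Longrightarrow> f t = 0"
          unfolding P_def by blast
        have van: "t = a" if "t \<in> I" "\<bar>t - y\<bar> < e" "\<bar>t - a\<bar> < \<delta>" for t
        proof (rule ccontr)
          assume "t \<noteq> a"
          then have "0 < c * \<bar>t - a\<bar> ^ N" using order(2) by simp
          then show False using order(4)[of t] e(2)[of t] that by simp
        qed
        have "min e (\<delta> - \<bar>y - a\<bar>) > 0"
          using e y by (auto simp: dist_real_def abs_minus_commute)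
        then obtain z where z: "z \<in> I" "z \<noteq> y" "\<bar>z - y\<bar> < min e (\<delta> - \<bar>y - a\<bar>)"
          using near_point_in_I y by blast
        have "y = a" using van[of y] y e by (auto simp: dist_real_def abs_minus_commute)
        moreover have "z = a" using van[of z] z by auto
        ultimately show False using z by simp
      qed
      then show ?thesis using op a order by (intro exI[of _ "I \<inter> ball a \<delta>"]) auto
    qed
  qed (use x y in auto)
  then show ?thesis using y unfolding P_def by force
qed

lemma analytic_on_I_local_order:
  assumes "analytic_on_I f" "t\<^sub>0 \<in> I" "f t\<^sub>0 \<noteq> 0" "x \<in> I"
  obtains \<delta> c N where "\<delta> > 0" "c > 0" "N = 0 \<or> f x = 0"
      "\<And>t. t \<in> I \<Longrightarrow> \<bar>t - x\<bar> < \<delta> \<Longrightarrow> c * \<bar>t - x\<bar> ^ N \<le> \<bar>f t\<bar>"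
  using assms(1,4)
proof (cases rule: analytic_on_I_local)
  case (flat \<delta>)
  then show ?thesis using analytic_on_I_identity[OF assms(1,4) flat assms(2)] assms(3) by simp
next
  case (order \<delta> c N)
  then show ?thesis by (rule that)
qed

lemma analytic_on_I_finite_zeros:
  assumes "analytic_on_I f" "t\<^sub>0 \<in> I" "f t\<^sub>0 \<noteq> 0"
  shows "finite {t \<in> I. f t = 0}"
proof (rule ccontr)
  assume "infinite {t \<in> I. f t = 0}"
  moreover have "compact I" by simp
  ultimately obtain x where x: "x \<in> I" "x islimpt {t \<in> I. f t = 0}"
    unfolding compact_eq_Bolzano_Weierstrass by (metis (no_types, lifting) mem_Collect_eq subsetI)
  obtain \<delta> c N where o: "\<delta> > 0" "c > 0"
      "\<And>t. t \<in> I \<Longrightarrow> \<bar>t - x\<bar> < \<delta> \<Longrightarrow> c * \<bar>t - x\<bar> ^ N \<le> \<bar>f t\<bar>"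
    using analytic_on_I_local_order[OF assms x(1)] by metis
  obtain t where "t \<in> I" "f t = 0" "t \<noteq> x" "\<bar>t - x\<bar> < \<delta>"
    using x(2) o(1) unfolding islimpt_approachable dist_real_def by blast
  moreover from this have "0 < c * \<bar>t - x\<bar> ^ N" using o by simp
  ultimately show False using o(3)[of t] by simp
qed

text \<open>An inequality of Lojasiewicz type: a weight that vanishes at the zeros of \<open>f\<close> is, after raising
  it to a high enough power, dominated by \<open>f\<close>. The exponent has to reach the order of every zero;
  stating this for all large \<open>r\<close> lets finitely many functions \<open>f\<close> share one exponent.\<close>

lemma analytic_on_I_Lojasiewicz:
  assumes f: "analytic_on_I f" "t\<^sub>0 \<in> I" "f t\<^sub>0 \<noteq> 0"
    and w1: "\<And>t. t \<in> I \<Longrightarrow> \<bar>w t\<bar> \<le> 1"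
    and w: "\<And>t z. t \<in> I \<Longrightarrow> z \<in> I \<Longrightarrow> f z = 0 \<Longrightarrow> \<bar>w t\<bar> \<le> \<bar>t - z\<bar>"
  shows "\<forall>\<^sub>F r in sequentially. \<exists>B. \<forall>t\<in>I. \<bar>w t\<bar> ^ r \<le> B * \<bar>f t\<bar>"
proof -
  define P where "P a b \<longleftrightarrow> (\<forall>\<^sub>F r in sequentially. \<exists>B. \<forall>t\<in>I. a \<le> t \<longrightarrow> t \<le> b \<longrightarrow> \<bar>w t\<bar> ^ r \<le> B * \<bar>f t\<bar>)" for a b
  have "P 0 (2 * pi)"
  proof (rule Bolzano)
    fix a b c assume "P a b" "P b c"
    then show "P a c" unfolding P_def
    proof eventually_elim
      case (elim r)
      then obtain B B' where B: "\<And>t. t \<in> I \<Longrightarrow> a \<le> t \<Longrightarrow> t \<le> b \<Longrightarrow> \<bar>w t\<bar> ^ r \<le> B * \<bar>f t\<bar>"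
        "\<And>t. t \<in> I \<Longrightarrow> b \<le> t \<Longrightarrow> t \<le> c \<Longrightarrow> \<bar>w t\<bar> ^ r \<le> B' * \<bar>f t\<bar>" by blast
      have m: "B * \<bar>f t\<bar> \<le> max B B' * \<bar>f t\<bar>" "B' * \<bar>f t\<bar> \<le> max B B' * \<bar>f t\<bar>" for t
        by (auto intro: mult_right_mono)
      have "\<bar>w t\<bar> ^ r \<le> max B B' * \<bar>f t\<bar>" if "t \<in> I" "a \<le> t" "t \<le> c" for t
        using B(1)[OF that(1,2)] B(2)[OF that(1) _ that(3)] m[of t] by linarith
      then show ?case by blast
    qed
  next
    fix x assume "0 \<le> x" "x \<le> 2 * pi"
    then have x: "x \<in> I" by simp
    obtain \<delta> c N where o: "\<delta> > 0" "c > 0" "N = 0 \<or> f x = 0"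
      "\<And>t. t \<in> I \<Longrightarrow> \<bar>t - x\<bar> < \<delta> \<Longrightarrow> c * \<bar>t - x\<bar> ^ N \<le> \<bar>f t\<bar>"
      using analytic_on_I_local_order[OF f x] by metis
    have b: "\<bar>w t\<bar> ^ r \<le> (1 / c) * \<bar>f t\<bar>" if "r \<ge> N" "t \<in> I" "\<bar>t - x\<bar> < \<delta>" for r t
    proof -
      have "\<bar>w t\<bar> ^ r \<le> \<bar>w t\<bar> ^ N" using that w1 by (intro power_decreasing) auto
      also have "\<dots> \<le> \<bar>t - x\<bar> ^ N" 
        using o(3) w[of t x] x that by (auto intro: power_mono)
      also have "\<dots> \<le> (1 / c) * \<bar>f t\<bar>" using o(2) o(4)[of t] that by (simp add: field_simps)
      finally show ?thesis .
    qed
    have "P a b" if "a \<le> x \<and> x \<le> b \<and> b - a < \<delta>" for a b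
      unfolding P_def using eventually_ge_at_top[of N]
    proof eventually_elim
      case (elim r)
      show ?case by (rule exI[of _ "1 / c"]) (use b elim that in auto)
    qed
    then show "\<exists>d>0. \<forall>a b. a \<le> x \<and> x \<le> b \<and> b - a < d \<longrightarrow> P a b" using o(1) by blast
  qed simp
  then show ?thesis unfolding P_def by simp
qed

section \<open>Chains of derivatives and antiderivatives\<close>

text \<open>The functions \<open>\<phi> n\<close> play the role of the iterated derivatives (\<open>n > 0\<close>) and antiderivatives
  (\<open>n < 0\<close>) of \<open>\<phi> 0\<close>. Chains are truncated at \<open>- m\<close> because a perturbation is built as an \<open>m\<close>-th
  derivative, so that only its first \<open>m\<close> antiderivatives are under control. Unlike \<^const>\<open>iterated\<close>,
  whose values are meaningful on \<^term>\<open>I\<close> only, a chain consists of functions on the whole line and is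
  closed under linear combinations.\<close>

definition derivative_chain :: "nat \<Rightarrow> (int \<Rightarrow> real \<Rightarrow> real) \<Rightarrow> bool" where
  "derivative_chain m \<phi> \<longleftrightarrow>
     (\<forall>n\<ge>- int m. \<forall>t. (\<phi> n has_real_derivative \<phi> (n + 1) t) (at t)) \<and>
     (\<forall>n\<ge>- int m. n < 0 \<longrightarrow> \<phi> n 0 = 0)"

lemma derivative_on_I_eq:
  assumes "\<And>t. t \<in> I \<Longrightarrow> u t = v t" "(v has_real_derivative d) (at t)" "t \<in> I"
  shows "derivative_on_I u t = d"
proof -
  have "(v has_vector_derivative d) (at t within I)"
    using assms(2) by (simp add: has_real_derivative_iff_has_vector_derivative has_vector_derivative_at_within)
  then have "(u has_vector_derivative d) (at t within I)"
    by (rule has_vector_derivative_transform[rotated 2]) (use assms in auto)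
  then show ?thesis
    unfolding derivative_on_I_def
    using vector_derivative_within_cbox[of 0 "2 * pi" t u d] assms(3) by (simp add: cbox_interval)
qed

lemma derivative_zero_on_I:
  assumes "\<And>t. t \<in> I \<Longrightarrow> f t = c" "(f has_real_derivative d) (at t)" "t \<in> I"
  shows "d = 0"
proof -
  have "derivative_on_I f t = d" by (rule derivative_on_I_eq) (use assms in auto)
  moreover have "derivative_on_I f t = 0"
    by (rule derivative_on_I_eq[of _ "\<lambda>_. c"]) (use assms in auto)
  ultimately show ?thesis by simp
qed

lemma iterated_chain:
  assumes c: "derivative_chain m \<phi>" and n: "- int m \<le> n" and t: "t \<in> I"
  shows "iterated n (\<phi> 0) t = \<phi> n t"
proof -
  have d: "(\<phi> n has_real_derivative \<phi> (n + 1) t) (at t)" if "- int m \<le> n" for n t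
    using c that unfolding derivative_chain_def by blast
  have up: "(derivative_on_I ^^ j) (\<phi> 0) t = \<phi> (int j) t" if "t \<in> I" for j t
    using that
  proof (induction j arbitrary: t)
    case (Suc j)
    have "derivative_on_I ((derivative_on_I ^^ j) (\<phi> 0)) t = \<phi> (int j + 1) t"
      by (rule derivative_on_I_eq[OF Suc.IH d]) (use Suc.prems in auto)
    then show ?case by (simp add: add.commute)
  qed simp
  have down: "j \<le> m \<longrightarrow> (antiderivative ^^ j) (\<phi> 0) t = \<phi> (- int j) t" if "t \<ge> 0" for j t
    using that
  proof (induction j arbitrary: t)
    case (Suc j)
    show ?case
    proof
      assume j: "Suc j \<le> m"
      have "antiderivative ((antiderivative ^^ j) (\<phi> 0)) t = integral {0..t} (\<phi> (- int j))"
        unfolding antiderivative_def[of "(antiderivative ^^ j) (\<phi> 0)"]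
        by (rule integral_cong) (use Suc.IH j in auto)
      also have "\<dots> = \<phi> (- int (Suc j)) t - \<phi> (- int (Suc j)) 0"
        using d[of "- int (Suc j)"] j Suc.prems
        by (intro integral_unique fundamental_theorem_of_calculus)
          (auto simp: has_real_derivative_iff_has_vector_derivative has_vector_derivative_at_within)
      also have "\<phi> (- int (Suc j)) 0 = 0"
        using c j unfolding derivative_chain_def by auto
      finally show "(antiderivative ^^ Suc j) (\<phi> 0) t = \<phi> (- int (Suc j)) t" by simp
    qed
  qed simp
  show ?thesis
    using up[OF t, of "nat n"] down[of t "nat (- n)"] n t by (auto simp: iterated_def)
qed

lemma real_entire_chain:
  assumes "real_entire k"
  obtains \<phi> where "\<phi> 0 = k" "\<And>n. real_entire (\<phi> n)" "\<And>m. derivative_chain m \<phi>"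
proof -
  define P where "P f = (SOME g. real_entire g \<and> (\<forall>t. (g has_real_derivative f t) (at t)) \<and> g 0 = 0)" for f
  have P: "real_entire (P f)" "(P f has_real_derivative f t) (at t)" "P f 0 = 0"
    if "real_entire f" for f t
  proof -
    have "\<exists>g. real_entire g \<and> (\<forall>t. (g has_real_derivative f t) (at t)) \<and> g 0 = 0"
      using real_entire_primitive[OF that] by blast
    from someI_ex[OF this, folded P_def]
    show "real_entire (P f)" "(P f has_real_derivative f t) (at t)" "P f 0 = 0" by auto
  qed
  define \<phi> where "\<phi> n = (if n \<ge> 0 then (deriv ^^ nat n) k else (P ^^ nat (- n)) k)" for n :: int
  have Pk: "real_entire ((P ^^ j) k)" for j
    by (induction j) (simp_all add: assms P(1))
  have e: "real_entire (\<phi> n)" for n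
    unfolding \<phi>_def using real_entire_funpow_deriv[OF assms] Pk by simp
  have d: "(\<phi> n has_real_derivative \<phi> (n + 1) t) (at t)" for n t
  proof (cases "n \<ge> 0")
    case True
    then have "\<phi> (n + 1) = deriv (\<phi> n)" by (simp add: \<phi>_def nat_add_distrib)
    then show ?thesis using real_entire_deriv(2)[OF e] by simp
  next
    case False
    then obtain j where j: "nat (- n) = Suc j" by (cases "nat (- n)") auto
    then have "nat (- (n + 1)) = j" "n + 1 < 0 \<or> j = 0" by auto
    then have "\<phi> (n + 1) = (P ^^ j) k" using False by (auto simp: \<phi>_def)
    moreover have "\<phi> n = P ((P ^^ j) k)" using False j by (simp add: \<phi>_def)
    ultimately show ?thesis using P(2)[OF Pk] by simp
  qed
  have z: "\<phi> n 0 = 0" if n: "n < 0" for n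
  proof -
    obtain j where j: "nat (- n) = Suc j" using n by (cases "nat (- n)") auto
    then have "\<phi> n = P ((P ^^ j) k)" using n by (simp add: \<phi>_def)
    then show ?thesis using P(3)[OF Pk] by simp
  qed
  show ?thesis
    by (rule that[of \<phi>]) (use e d z in \<open>auto simp: \<phi>_def[of 0] derivative_chain_def\<close>)
qed

text \<open>If the \<open>Suc n\<close>-th derivative is a constant \<open>c\<close>, then the \<open>n\<close>-th derivative grows by \<open>2 * pi * c\<close> over
  a period; being periodic, it forces \<open>c = 0\<close>. Descending in \<open>n\<close>, the function itself is constant.\<close>

lemma periodic_chain_constant:
  fixes \<psi> :: "nat \<Rightarrow> real \<Rightarrow> real"
  assumes d: "\<And>i t. (\<psi> i has_real_derivative \<psi> (Suc i) t) (at t)"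
    and per: "\<And>t. \<psi> 0 (t + 2 * pi) = \<psi> 0 t"
    and c: "\<And>t. t \<in> I \<Longrightarrow> \<psi> n t = c" and t: "t \<in> I"
  shows "\<psi> 0 t = \<psi> 0 0"
proof -
  have per: "\<psi> i (t + 2 * pi) = \<psi> i t" for i t
  proof (induction i arbitrary: t)
    case (Suc i)
    have "((\<lambda>t. \<psi> i (t + 2 * pi)) has_real_derivative \<psi> (Suc i) (t + 2 * pi)) (at t)"
      using d[of i "t + 2 * pi"] by (simp only: DERIV_shift)
    then have "(\<psi> i has_real_derivative \<psi> (Suc i) (t + 2 * pi)) (at t)"
      by (simp only: Suc.IH)
    then show ?case using d DERIV_unique by blast
  qed (rule per)
  have mvt: "\<exists>z\<in>I. \<psi> i s - \<psi> i 0 = s * \<psi> (Suc i) z" if "0 < s" "s \<le> 2 * pi" for i s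
  proof -
    have "\<exists>z>0. z < s \<and> \<psi> i s - \<psi> i 0 = (s - 0) * \<psi> (Suc i) z"
      by (rule MVT2[OF that(1) d])
    then obtain z where "z > 0" "z < s" "\<psi> i s - \<psi> i 0 = (s - 0) * \<psi> (Suc i) z" by blast
    then show ?thesis using that by (intro bexI[of _ z]) auto
  qed
  from c show ?thesis
  proof (induction n arbitrary: c)
    case 0
    then show ?case using t by simp
  next
    case (Suc n)
    have "\<psi> n (2 * pi) - \<psi> n 0 = 2 * pi * c" 
      using mvt[of "2 * pi" n] Suc.prems by auto
    then have "c = 0" using per[of n 0] by simp
    then have "\<psi> n s = \<psi> n 0" if "s \<in> I" for s
      using mvt[of s n] Suc.prems that by (cases "s = 0") auto
    then show ?case by (rule Suc.IH)
  qed
qed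

section \<open>A family of closed curves\<close>

lemma closed_curve_iff:
  assumes \<theta>: "\<And>t. t \<in> I \<Longrightarrow> integral {0..t} k = \<theta> t" and c: "continuous_on I \<theta>"
  shows "closed_curve k \<longleftrightarrow> integral I (\<lambda>t. cos (\<theta> t)) = 0 \<and> integral I (\<lambda>t. sin (\<theta> t)) = 0"
proof -
  have "curve k (2 * pi) = integral I (\<lambda>t. cis (\<theta> t))"
    unfolding curve_def by (rule integral_cong) (simp add: \<theta> cis_conv_exp)
  moreover have i: "(\<lambda>t. cis (\<theta> t)) integrable_on I"
    by (intro integrable_continuous_real continuous_intros c)
  have "Re (integral I (\<lambda>t. cis (\<theta> t))) = integral I (\<lambda>t. cos (\<theta> t))"
    "Im (integral I (\<lambda>t. cis (\<theta> t))) = integral I (\<lambda>t. sin (\<theta> t))"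
    using integral_linear[OF i bounded_linear_Re] integral_linear[OF i bounded_linear_Im]
    by (simp_all add: o_def)
  moreover have "curve k 0 = 0" by (simp add: curve_def)
  ultimately show ?thesis unfolding closed_curve_def by (auto simp: complex_eq_iff)
qed

lemma integral_antiperiodic:
  fixes f :: "real \<Rightarrow> real"
  assumes c: "continuous_on UNIV f" and "\<And>t. f (t + pi) = - f t"
  shows "integral I f = 0"
proof -
  have c: "continuous_on S f" for S using c continuous_on_subset by blast
  have "integral {0..2 * pi} f = integral {0..pi} f + integral {pi..2 * pi} f"
    using Henstock_Kurzweil_Integration.integral_combine[of 0 pi "2 * pi" f] integrable_continuous_real[OF c]
    by simp
  also have "integral {pi..2 * pi} f = integral {0..pi} (f \<circ> (\<lambda>t. t + pi))"
    using integral_shift[OF c, of 0 pi pi] by simp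
  also have "\<dots> = - integral {0..pi} f"
    by (simp add: o_def assms(2))
  finally show ?thesis by simp
qed

text \<open>A tangent angle that increases by \<open>pi\<close> when \<open>t\<close> does reverses the tangent vector, so the curve is
  centrally symmetric and closes up after \<open>2 * pi\<close>, for every value of the parameter \<open>s\<close>. The exponential
  makes the curvatures for different \<open>s > 0\<close> linearly independent.\<close>

definition sym_angle :: "real \<Rightarrow> real \<Rightarrow> real" where
  "sym_angle s t = t + exp s - exp (s * cos (2 * t))"

definition sym_curvature :: "real \<Rightarrow> real \<Rightarrow> real" where
  "sym_curvature s t = 1 + 2 * s * sin (2 * t) * exp (s * cos (2 * t))"

lemma sym_angle_deriv: "(sym_angle s has_real_derivative sym_curvature s t) (at t)"
  unfolding sym_angle_def[abs_def] sym_curvature_def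
  by (auto intro!: derivative_eq_intros)

lemma sym_angle_0: "sym_angle s 0 = 0" by (simp add: sym_angle_def)

lemma sym_angle_shift: "sym_angle s (t + pi) = sym_angle s t + pi"
  by (simp add: sym_angle_def distrib_left)

lemma real_entire_sym_curvature: "real_entire (sym_curvature s)"
  unfolding sym_curvature_def[abs_def] by (intro real_entire_intros)

lemma sym_angle_chain:
  assumes "derivative_chain m \<phi>" "m > 0" "\<phi> 0 = sym_curvature s"
  shows "\<phi> (-1) = sym_angle s"
proof
  fix t
  have d: "(\<phi> (-1) has_real_derivative sym_curvature s t) (at t)" for t
    using assms(1)[unfolded derivative_chain_def, THEN conjunct1, rule_format, of "-1" t] assms(2,3) by simp
  have "((\<lambda>t. \<phi> (-1) t - sym_angle s t) has_real_derivative 0) (at t)" for t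
    using DERIV_diff[OF d[of t] sym_angle_deriv[of s t]] by simp
  then have "\<phi> (-1) t - sym_angle s t = \<phi> (-1) 0 - sym_angle s 0"
    using DERIV_isconst_all by blast
  moreover have "\<phi> (-1) 0 = 0" using assms unfolding derivative_chain_def by auto
  ultimately show "\<phi> (-1) t = sym_angle s t" by (simp add: sym_angle_0)
qed

section \<open>Linear independence\<close>

text \<open>Dividing by one of the exponentials and differentiating removes it from the relation and multiplies
  the coefficients of the others by nonzero differences.\<close>

lemma exponentials_independent:
  fixes a :: "real \<Rightarrow> real"
  assumes "finite S" "\<And>x. \<bar>x\<bar> < 1 \<Longrightarrow> (\<Sum>s\<in>S. a s * exp (s * x)) = 0" "s \<in> S"
  shows "a s = 0"
  using assms
proof (induction S arbitrary: a s rule: finite_induct)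
  case (insert s\<^sub>0 S)
  let ?f = "\<lambda>x. a s\<^sub>0 + (\<Sum>s\<in>S. a s * exp ((s - s\<^sub>0) * x))"
  have f0: "?f x = 0" if "\<bar>x\<bar> < 1" for x
  proof -
    have "?f x = exp (- s\<^sub>0 * x) * (\<Sum>s\<in>insert s\<^sub>0 S. a s * exp (s * x))"
      using insert.hyps
      by (simp add: distrib_left sum_distrib_left left_diff_distrib exp_diff exp_minus field_simps)
    then show ?thesis using insert.prems(1)[OF that] by simp
  qed
  have "a s * (s - s\<^sub>0) = 0" if "s \<in> S" for s
  proof (rule insert.IH[OF _ that])
    fix x :: real assume x: "\<bar>x\<bar> < 1"
    let ?d = "\<Sum>s\<in>S. a s * ((s - s\<^sub>0) * exp ((s - s\<^sub>0) * x))"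
    have "(?f has_real_derivative ?d) (at x)"
      by (auto intro!: derivative_eq_intros simp: mult_ac)
    then have "((\<lambda>_. 0) has_real_derivative ?d) (at x)"
      by (rule has_field_derivative_transform_within_open[of _ _ _ "{-1<..<1}"]) (use x f0 in auto)
    then have "?d = 0" using DERIV_const DERIV_unique by blast
    moreover have "(\<Sum>s\<in>S. a s * (s - s\<^sub>0) * exp (s * x)) = exp (s\<^sub>0 * x) * ?d"
      unfolding sum_distrib_left
      by (rule sum.cong) (simp_all add: left_diff_distrib exp_diff)
    ultimately show "(\<Sum>s\<in>S. a s * (s - s\<^sub>0) * exp (s * x)) = 0" by simp
  qed
  then have "\<forall>s\<in>S. a s = 0" using insert.hyps by fastforce
  moreover from this have "a s\<^sub>0 = 0" using f0[of 0] by simp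
  ultimately show ?case using insert.prems by auto
qed simp

text \<open>A linear relation between the \<open>n\<close>-th derivatives (or antiderivatives) propagates to \<open>n = 0\<close>: upwards
  by differentiation, downwards by periodicity, up to an additive constant. The value at \<open>t = 0\<close>
  identifies this constant with the contribution of the summands \<open>1\<close> in the curvatures; what remains
  is a relation between the exponentials \<open>exp (s * x)\<close> with \<open>x = cos (2 * t)\<close>.\<close>

lemma sym_curvature_chains_independent:
  fixes a :: "real \<Rightarrow> real"
  assumes S: "finite S" "S \<subseteq> {0<..}"
    and chain: "\<And>s m. derivative_chain m (\<Phi> s)" and \<Phi>0: "\<And>s. \<Phi> s 0 = sym_curvature s"
    and zero: "\<And>t. t \<in> I \<Longrightarrow> (\<Sum>s\<in>S. a s * \<Phi> s n t) = 0" and s: "s \<in> S"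
  shows "a s = 0"
proof -
  define \<psi> where "\<psi> j t = (\<Sum>s\<in>S. a s * \<Phi> s j t)" for j t
  have "(\<Phi> s j has_real_derivative \<Phi> s (j + 1) t) (at t)" for s j t
    using chain[of "nat (- j)" s] unfolding derivative_chain_def by auto
  then have d: "(\<psi> j has_real_derivative \<psi> (j + 1) t) (at t)" for j t
    unfolding \<psi>_def[abs_def] by (auto intro!: derivative_eq_intros simp: mult.commute)
  have \<psi>0: "\<psi> 0 t = (\<Sum>s\<in>S. a s) + 2 * sin (2 * t) * (\<Sum>s\<in>S. a s * s * exp (s * cos (2 * t)))" for t
    by (simp add: \<psi>_def \<Phi>0 sym_curvature_def sum_distrib_left sum.distrib algebra_simps)
  have const: "\<psi> 0 t = \<psi> 0 0" if t: "t \<in> I" for t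
  proof (cases "n \<ge> 0")
    case True
    show ?thesis
    proof (rule periodic_chain_constant[of "\<lambda>i. \<psi> (int i)" "nat n" 0 t, simplified])
      show "(\<psi> (int i) has_real_derivative \<psi> (1 + int i) t) (at t)" for i t
        using d[of "int i"] by (simp add: add.commute)
      have "sin (2 * (t + 2 * pi)) = sin (2 * t + 2 * pi + 2 * pi)"
        "cos (2 * (t + 2 * pi)) = cos (2 * t + 2 * pi + 2 * pi)" for t by (simp_all add: algebra_simps)
      then show "\<psi> 0 (t + 2 * pi) = \<psi> 0 t" for t
        unfolding \<psi>0 by (simp only: sin_periodic cos_periodic)
    qed (use True t zero in \<open>auto simp: \<psi>_def\<close>)
  next
    case False
    have "\<forall>t\<in>I. \<psi> j t = 0" if "n \<le> j" for j
      using that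
    proof (induction j rule: int_ge_induct)
      case base
      then show ?case using zero by (simp add: \<psi>_def)
    next
      case (step j)
      then show ?case using derivative_zero_on_I[OF _ d] by blast
    qed
    then show ?thesis using False t by simp
  qed
  have "(\<Sum>s\<in>S. a s * s * exp (s * x)) = 0" if x: "\<bar>x\<bar> < 1" for x
  proof -
    define t where "t = arccos x / 2"
    have x': "-1 < x" "x < 1" using x by auto
    have b: "0 < arccos x" "arccos x < pi"
      using arccos_lt_bounded[OF x'] by auto
    then have t: "t \<in> I" "cos (2 * t) = x" "sin (2 * t) > 0"
      using x' by (auto simp: t_def sin_gt_zero)
    have "2 * sin (2 * t) * (\<Sum>s\<in>S. a s * s * exp (s * cos (2 * t))) = 0"
      using const[OF t(1)] unfolding \<psi>0 by simp
    then show ?thesis using t by simp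
  qed
  from exponentials_independent[OF S(1), of "\<lambda>s. a s * s", OF this s]
  show ?thesis using S s by auto
qed

text \<open>The bound of the size of an independent set in a finitely generated space, applied to the vector
  space of functions. Functions are cut off outside \<open>X\<close> so that equality on \<open>X\<close> becomes equality.\<close>

lemma finite_if_independent_in_span:
  fixes e :: "'i \<Rightarrow> 'x \<Rightarrow> real" and l :: "'j \<Rightarrow> 'x \<Rightarrow> real"
  assumes indep: "\<And>T a s. finite T \<Longrightarrow> T \<subseteq> S \<Longrightarrow> (\<And>t. t \<in> X \<Longrightarrow> (\<Sum>s\<in>T. a s * e s t) = 0) \<Longrightarrow>
      s \<in> T \<Longrightarrow> a s = 0"
    and span: "\<And>s. s \<in> S \<Longrightarrow> \<exists>c. \<forall>t\<in>X. e s t = (\<Sum>j\<in>J. c j * l j t)"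
    and J: "finite J"
  shows "finite S"
proof -
  define scale where "scale c f = (\<lambda>t. c * f t)" for c :: real and f :: "'x \<Rightarrow> real"
  define res where "res f = (\<lambda>t. if t \<in> X then f t else 0)" for f :: "'x \<Rightarrow> real"
  interpret vector_space scale
    by standard (auto simp: scale_def fun_eq_iff algebra_simps)
  have sum_apply: "(\<Sum>i\<in>A. g i) t = (\<Sum>i\<in>A. g i t)" for A t and g :: "'k \<Rightarrow> 'x \<Rightarrow> real"
    by (induction A rule: infinite_finite_induct) auto
  have inj: "inj_on (\<lambda>s. res (e s)) S"
  proof (rule inj_onI, rule ccontr)
    fix s s' assume s: "s \<in> S" "s' \<in> S" "res (e s) = res (e s')" "s \<noteq> s'"
    have "e s t = e s' t" if "t \<in> X" for t
      using fun_cong[OF s(3), of t] that by (simp add: res_def)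
    then have "(if s = s then 1 else - 1 :: real) = 0"
      by (intro indep[of "{s, s'}" "\<lambda>i. if i = s then 1 else -1" s]) (use s in auto)
    then show False by simp
  qed
  have "independent ((\<lambda>s. res (e s)) ` S)"
    unfolding dependent_explicit
  proof (safe, goal_cases)
    case (1 T u f)
    obtain T' where T': "T' \<subseteq> S" "T = (\<lambda>s. res (e s)) ` T'" "inj_on (\<lambda>s. res (e s)) T'"
      using 1(2) inj by (metis subset_image_inj)
    then have "finite T'" using 1(1) finite_imageD by blast
    have "(\<Sum>s\<in>T'. u (res (e s)) * e s t) = 0" if "t \<in> X" for t
    proof -
      have "(\<Sum>v\<in>T. scale (u v) v) t = 0" using 1 by simp
      then show ?thesis using that T'
        by (simp add: sum_apply sum.reindex) (simp add: scale_def res_def)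
    qed
    then have "u (res (e s)) = 0" if "s \<in> T'" for s
      using indep[OF \<open>finite T'\<close> T'(1), of "\<lambda>s. u (res (e s))"] that by blast
    then show False using 1 T' by auto
  qed
  moreover have "(\<lambda>s. res (e s)) ` S \<subseteq> span ((\<lambda>j. res (l j)) ` J)"
  proof safe
    fix s assume "s \<in> S"
    then obtain c where c: "\<And>t. t \<in> X \<Longrightarrow> e s t = (\<Sum>j\<in>J. c j * l j t)" using span by blast
    have "res (e s) = (\<Sum>j\<in>J. scale (c j) (res (l j)))"
      by (auto simp: fun_eq_iff sum_apply scale_def res_def c)
    also have "\<dots> \<in> span ((\<lambda>j. res (l j)) ` J)"
      by (intro span_sum span_scale span_base imageI)
    finally show "res (e s) \<in> span ((\<lambda>j. res (l j)) ` J)" .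
  qed
  ultimately have "finite ((\<lambda>s. res (e s)) ` S)"
    using independent_span_bound J by blast
  then show ?thesis using inj finite_imageD by blast
qed

text \<open>For each order \<open>n\<close> and each \<open>N\<close>, only finitely many parameters \<open>0 < s < 1\<close> yield an \<open>n\<close>-th
  derivative in the span of \<open>l 1, \<dots>, l N\<close>. So all but countably many of these parameters avoid all
  combinations at all orders, and the answer that the two functions coincide never occurs.\<close>

lemma generic_parameter:
  assumes chain: "\<And>s m. derivative_chain m (\<Phi> s)" and \<Phi>0: "\<And>s. \<Phi> s 0 = sym_curvature s"
  obtains s where "\<And>n c. c \<in> coeffs_C \<Longrightarrow> \<exists>t\<in>I. \<Phi> s n t \<noteq> combination l c t"
proof -
  define bad where "bad n N = {s \<in> {0<..<1}. \<exists>c. \<forall>t\<in>I. \<Phi> s n t = (\<Sum>j\<in>{1..N}. c j * l j t)}"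
    for n :: int and N :: nat
  have "finite (bad n N)" for n N
  proof (rule finite_if_independent_in_span[where X = I and e = "\<lambda>s. \<Phi> s n" and l = l and J = "{1..N}"])
    fix T a s
    assume "finite T" "T \<subseteq> bad n N" "\<And>t. t \<in> I \<Longrightarrow> (\<Sum>s\<in>T. a s * \<Phi> s n t) = 0" "s \<in> T"
    then show "a s = 0"
      by (intro sym_curvature_chains_independent[where S = T and a = a and \<Phi> = \<Phi> and n = n, OF _ _ chain \<Phi>0])
        (auto simp: bad_def)
  next
    show "\<exists>c. \<forall>t\<in>I. \<Phi> s n t = (\<Sum>j\<in>{1..N}. c j * l j t)" if "s \<in> bad n N" for s
      using that unfolding bad_def mem_Collect_eq by (rule conjunct2)
  qed simp
  then have "countable (\<Union>n. \<Union>N. bad n N)" by (simp add: countable_finite)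
  moreover have "uncountable {0<..<1::real}" by (simp add: uncountable_open_interval)
  ultimately obtain s where s: "s \<in> {0<..<1}" "s \<notin> (\<Union>n. \<Union>N. bad n N)"
    using countable_subset[of "{0<..<1}"] by (metis subsetI)
  show ?thesis
  proof (rule that)
    fix n c assume "c \<in> coeffs_C"
    then have "\<exists>N. \<forall>j\<ge>N. c j = 0" by (simp add: coeffs_C_def eventually_sequentially)
    then obtain N where N: "\<And>j. j \<ge> N \<Longrightarrow> c j = 0"
      by blast
    have "j \<le> N" if "c j \<noteq> 0" for j
      using N[of j] that by (cases "N \<le> j") auto
    then have "{j. j \<ge> 1 \<and> c j \<noteq> 0} \<subseteq> {1..N}" by auto
    then have "combination l c t = (\<Sum>j\<in>{1..N}. c j * l j t)" for t
      unfolding combination_def by (intro sum.mono_neutral_left) auto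
    then show "\<exists>t\<in>I. \<Phi> s n t \<noteq> combination l c t"
      using s unfolding bad_def by auto
  qed
qed

section \<open>Runs of a procedure\<close>

text \<open>A run that stops has asked only finitely many queries, and depends on the input through
  their answers alone.\<close>

lemma run_output_finite_queries:
  assumes "run_output H M G a v"
  shows "\<exists>Q. finite Q \<and> Q \<subseteq> range M \<and> (\<forall>H'. (\<forall>q\<in>Q. H' q = H q) \<longrightarrow> run_output H' M G a v)"
  using assms
proof induction
  case (stop a v)
  then show ?case by (intro exI[of _ "{M a}"]) (auto intro: run_output.stop)
next
  case (continue a a' v)
  then obtain Q where "finite Q" "Q \<subseteq> range M"
    "\<And>H'. \<forall>q\<in>Q. H' q = H q \<Longrightarrow> run_output H' M G a' v" by blast
  with continue.hyps(1) show ?case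
    by (intro exI[of _ "insert (M a) Q"]) (auto intro: run_output.continue)
qed

lemma run_output_unique:
  assumes "run_output H M G a v" "run_output H M G a v'"
  shows "v = v'"
  using assms
proof (induction arbitrary: v')
  case (stop a v)
  from stop.prems stop.hyps show ?case by cases auto
next
  case (continue a a' v)
  from continue.prems continue.hyps show ?case by cases (auto intro: continue.IH)
qed

section \<open>Perturbing the curvature\<close>

lemma integral_by_parts_iterated:
  assumes "real_entire u" "real_entire w"
    and "\<And>i. i < M \<Longrightarrow> (deriv ^^ i) w 0 = 0" "\<And>i. i < M \<Longrightarrow> (deriv ^^ i) w (2 * pi) = 0"
  shows "integral I (\<lambda>t. u t * (deriv ^^ M) w t) = (-1) ^ M * integral I (\<lambda>t. (deriv ^^ M) u t * w t)"
  using assms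
proof (induction M arbitrary: u)
  case (Suc M)
  let ?v = "(deriv ^^ M) w"
  have v: "real_entire ?v" using Suc.prems real_entire_funpow_deriv by blast
  note cont = real_entire_continuous[OF Suc.prems(1)] real_entire_continuous[OF v]
    real_entire_continuous[OF real_entire_deriv(1)[OF Suc.prems(1)]]
    real_entire_continuous[OF real_entire_deriv(1)[OF v]]
  have "((\<lambda>t. u t * ?v t) has_vector_derivative (deriv u t * ?v t + u t * deriv ?v t)) (at t within I)" for t
    using DERIV_mult[OF real_entire_deriv(2)[OF Suc.prems(1)] real_entire_deriv(2)[OF v], of t]
    by (simp add: has_real_derivative_iff_has_vector_derivative has_vector_derivative_at_within mult.commute)
  then have "((\<lambda>t. deriv u t * ?v t + u t * deriv ?v t) has_integral
      (u (2 * pi) * ?v (2 * pi) - u 0 * ?v 0)) I"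
    by (intro fundamental_theorem_of_calculus) auto
  then have "integral I (\<lambda>t. deriv u t * ?v t + u t * deriv ?v t) = 0"
    using Suc.prems(3,4)[of M] by (simp add: integral_unique)
  moreover have "integral I (\<lambda>t. deriv u t * ?v t + u t * deriv ?v t)
      = integral I (\<lambda>t. deriv u t * ?v t) + integral I (\<lambda>t. u t * deriv ?v t)"
    by (intro integral_add integrable_continuous_real continuous_intros cont)
  moreover have "integral I (\<lambda>t. deriv u t * ?v t) = (-1) ^ M * integral I (\<lambda>t. (deriv ^^ M) (deriv u) t * w t)"
    using Suc.prems real_entire_deriv by (intro Suc.IH) auto
  ultimately show ?case by (simp add: funpow_swap1)
qed simp

text \<open>Each derivative lowers the order of vanishing at the zeros of \<open>\<omega>\<close> by one.\<close>

lemma funpow_deriv_power_mult: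
  assumes w: "real_entire \<omega>" and h: "real_entire h" and j: "j \<le> R"
  shows "\<exists>h'. real_entire h' \<and> (deriv ^^ j) (\<lambda>t. \<omega> t ^ R * h t) = (\<lambda>t. \<omega> t ^ (R - j) * h' t)"
  using j
proof (induction j)
  case (Suc j)
  then obtain h' where h': "real_entire h'"
    "(deriv ^^ j) (\<lambda>t. \<omega> t ^ R * h t) = (\<lambda>t. \<omega> t ^ (R - j) * h' t)" by auto
  obtain q where q: "R - j = Suc q" "R - Suc j = q" using Suc.prems by (cases "R - j") auto
  let ?h = "\<lambda>t. real (Suc q) * deriv \<omega> t * h' t + \<omega> t * deriv h' t"
  have "((\<lambda>t. \<omega> t ^ Suc q * h' t) has_real_derivative \<omega> t ^ q * ?h t) (at t)" for t
    by (rule derivative_eq_intros real_entire_deriv(2)[OF w] real_entire_deriv(2)[OF h'(1)] refl)+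
      (simp add: algebra_simps)
  then have "deriv (\<lambda>t. \<omega> t ^ Suc q * h' t) = (\<lambda>t. \<omega> t ^ q * ?h t)"
    using DERIV_imp_deriv by blast
  moreover have "real_entire ?h"
    by (intro real_entire_intros w h' real_entire_deriv(1))
  ultimately show ?case using h'(2) q by auto
qed (use h in auto)

text \<open>The derivative of the integral at \<open>\<epsilon> = 0\<close> is the integral of \<open>cos (\<theta> t) * P t\<close>.\<close>

lemma first_variation_sin:
  fixes \<theta> P :: "real \<Rightarrow> real"
  assumes \<theta>: "continuous_on I \<theta>" and P: "continuous_on I P"
    and 0: "integral I (\<lambda>t. sin (\<theta> t)) = 0" and A: "integral I (\<lambda>t. cos (\<theta> t) * P t) \<noteq> 0"
  shows "\<forall>\<^sub>F \<epsilon> in at_right 0. integral I (\<lambda>t. sin (\<theta> t + \<epsilon> * P t)) \<noteq> 0"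
proof -
  let ?F = "\<lambda>\<epsilon>. integral (cbox 0 (2 * pi)) (\<lambda>t. sin (\<theta> t + \<epsilon> * P t))"
  have c: "continuous_on (UNIV \<times> I) (\<lambda>x. \<theta> (snd x))" "continuous_on (UNIV \<times> I) (\<lambda>x. P (snd x))"
    by (auto intro!: continuous_on_compose2[OF \<theta>] continuous_on_compose2[OF P] continuous_intros)
  have "(?F has_field_derivative integral (cbox 0 (2 * pi)) (\<lambda>t. cos (\<theta> t + 0 * P t) * P t)) (at 0 within UNIV)"
  proof (rule leibniz_rule_field_derivative)
    show "continuous_on (UNIV \<times> cbox 0 (2 * pi)) (\<lambda>(\<epsilon>, t). cos (\<theta> t + \<epsilon> * P t) * P t)"
      using c by (auto simp: case_prod_unfold cbox_interval intro!: continuous_intros)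
    show "(\<lambda>t. sin (\<theta> t + \<epsilon> * P t)) integrable_on cbox 0 (2 * pi)" for \<epsilon>
      unfolding cbox_interval by (intro integrable_continuous_real continuous_intros \<theta> P)
  qed (auto intro!: derivative_eq_intros)
  then have "((\<lambda>\<epsilon>. (?F \<epsilon> - ?F 0) / (\<epsilon> - 0)) \<longlongrightarrow> integral I (\<lambda>t. cos (\<theta> t) * P t)) (at 0)"
    by (simp add: has_field_derivative_iff cbox_interval)
  then have "\<forall>\<^sub>F \<epsilon> in at 0. (?F \<epsilon> - ?F 0) / (\<epsilon> - 0) \<noteq> 0"
    using A tendsto_imp_eventually_ne by blast
  then have "\<forall>\<^sub>F \<epsilon> in at 0. integral I (\<lambda>t. sin (\<theta> t + \<epsilon> * P t)) \<noteq> 0"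
    by eventually_elim (auto simp: 0 cbox_interval)
  then show ?thesis by (rule filter_leD[OF at_le, rotated]) simp
qed

text \<open>The weight is a product of linear factors, scaled by the length of the interval so that each of them
  has absolute value at most \<open>1\<close> on it.\<close>

lemma weight_product:
  assumes Z: "finite Z" "Z \<subseteq> I"
  obtains \<omega> where "real_entire \<omega>" "\<And>t. \<omega> t = 0 \<longleftrightarrow> t \<in> Z" "\<And>t. t \<in> I \<Longrightarrow> \<bar>\<omega> t\<bar> \<le> 1"
    "\<And>t z. t \<in> I \<Longrightarrow> z \<in> Z \<Longrightarrow> \<bar>\<omega> t\<bar> \<le> \<bar>t - z\<bar>"
proof
  define \<omega> where "\<omega> t = (\<Prod>z\<in>Z. (t - z) * (1 / (2 * pi)))" for t
  show "real_entire \<omega>" unfolding \<omega>_def[abs_def] by (intro real_entire_intros)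
  show "\<omega> t = 0 \<longleftrightarrow> t \<in> Z" for t using Z by (auto simp: \<omega>_def)
  have f: "\<bar>(t - z) * (1 / (2 * pi))\<bar> \<le> 1" if "t \<in> I" "z \<in> I" for t z
    using that by (auto simp: abs_mult)
  have le1: "(\<Prod>z\<in>S. \<bar>(t - z) * (1 / (2 * pi))\<bar>) \<le> 1" if "t \<in> I" "S \<subseteq> Z" for t S
    by (rule prod_le_1) (use f that Z in auto)
  show "\<bar>\<omega> t\<bar> \<le> 1" if "t \<in> I" for t
    using le1[OF that order_refl] by (simp add: \<omega>_def abs_prod)
  show "\<bar>\<omega> t\<bar> \<le> \<bar>t - z\<bar>" if t: "t \<in> I" and z: "z \<in> Z" for t z
  proof -
    have "\<bar>\<omega> t\<bar> = \<bar>(t - z) * (1 / (2 * pi))\<bar> * (\<Prod>z\<in>Z - {z}. \<bar>(t - z) * (1 / (2 * pi))\<bar>)"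
      using prod.remove[OF Z(1) z, of "\<lambda>z. \<bar>(t - z) * (1 / (2 * pi))\<bar>"] by (simp only: \<omega>_def abs_prod)
    also have "\<dots> \<le> \<bar>(t - z) * (1 / (2 * pi))\<bar> * 1"
      by (intro mult_left_mono le1 t) auto
    also have "\<dots> \<le> \<bar>t - z\<bar>"
    proof -
      have "1 / (2 * pi) \<le> 1" using pi_ge_two by simp
      then show ?thesis using mult_left_mono[of "1 / (2 * pi)" 1 "\<bar>t - z\<bar>"] by (simp add: abs_mult)
    qed
    finally show ?thesis .
  qed
qed

text \<open>When \<open>\<epsilon> * C < 1\<close>, the perturbation \<open>\<epsilon> * p\<close> is too small to cancel \<open>f - g\<close> where this is nonzero, and it
  vanishes where \<open>f - g\<close> does.\<close>

lemma solutions_stable: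
  assumes le: "\<And>t. t \<in> I \<Longrightarrow> \<bar>p t\<bar> \<le> C * \<bar>f t - g t\<bar>"
  shows "\<forall>\<^sub>F \<epsilon> in at_right 0. solutions (\<lambda>t. f t + \<epsilon> * p t) g = solutions f g"
proof -
  have "((\<lambda>\<epsilon>. \<epsilon> * C) \<longlongrightarrow> 0) (at_right 0)"
    by (auto intro!: tendsto_eq_intros)
  then have "\<forall>\<^sub>F \<epsilon> in at_right 0. \<epsilon> * C < 1"
    by (rule order_tendstoD) simp
  then show ?thesis using eventually_at_right_less[of 0]
  proof eventually_elim
    case (elim \<epsilon>)
    have "f t + \<epsilon> * p t = g t \<longleftrightarrow> f t = g t" if t: "t \<in> I" for t
    proof
      assume "f t = g t"
      then show "f t + \<epsilon> * p t = g t" using le[OF t] by simp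
    next
      assume eq: "f t + \<epsilon> * p t = g t"
      show "f t = g t"
      proof (rule ccontr)
        assume "f t \<noteq> g t"
        then have pos: "\<bar>f t - g t\<bar> > 0" by simp
        have "f t - g t = - (\<epsilon> * p t)" using eq by simp
        then have "\<bar>f t - g t\<bar> = \<epsilon> * \<bar>p t\<bar>"
          using elim by (simp add: abs_mult)
        also have "\<dots> \<le> \<epsilon> * C * \<bar>f t - g t\<bar>"
          using mult_left_mono[OF le[OF t], of \<epsilon>] elim by (simp add: mult.assoc)
        also have "\<dots> < 1 * \<bar>f t - g t\<bar>"
          using elim pos by (intro mult_strict_right_mono) auto
        finally show False by simp
      qed
    qed
    then show ?case by (auto simp: solutions_def)
  qed
qed

lemma access_cong:
  assumes "c \<in> coeffs_C" "\<And>t. t \<in> I \<Longrightarrow> iterated n k t = f t" "\<And>t. t \<in> I \<Longrightarrow> iterated n k' t = f' t"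
    and "\<sigma> = Ev \<Longrightarrow> f (c 0) = f' (c 0)"
    and "\<sigma> = Cap \<Longrightarrow> solutions f (combination l c) = solutions f' (combination l c)"
  shows "access b ns co l k (\<sigma>, n, c) = access b ns co l k' (\<sigma>, n, c)"
proof (cases \<sigma>)
  case Ev
  then show ?thesis using assms by (simp add: coeffs_C_def)
next
  case Cap
  have "solutions (iterated n k) (combination l c) = solutions f (combination l c)"
    "solutions (iterated n k') (combination l c) = solutions f' (combination l c)"
    using assms(2,3) by (auto simp: solutions_def)
  then show ?thesis using Cap assms(5) by (simp add: level_set_def)
qed

text \<open>The perturbation is \<open>\<epsilon>\<close> times the derivative of order \<open>M + 1\<close> of \<open>w = \<omega> ^ R * v\<close>, where \<open>\<omega>\<close> vanishes
  at all evaluation points and at all points of the level sets in question, as well as at \<open>0\<close> and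
  \<open>2 * pi\<close>. Since \<open>R\<close> is large, all derivatives of \<open>w\<close> that matter contain a high power of \<open>\<omega>\<close>: hence no
  evaluation changes, the antiderivatives taken from \<open>0\<close> are the lower derivatives of \<open>w\<close>, and the level
  sets are stable by \<open>analytic_on_I_Lojasiewicz\<close> and \<open>solutions_stable\<close>.

  The tangent angle \<open>\<theta> = \<phi> (-1)\<close> changes by \<open>\<epsilon>\<close> times the \<open>M\<close>-th derivative of \<open>w\<close>, and \<open>M\<close> integrations
  by parts turn the first variation of the integral of \<open>sin \<theta>\<close> into the integral of \<open>\<omega> ^ R * v\<close> against
  the \<open>M\<close>-th derivative of \<open>cos \<theta>\<close>, up to sign. Taking \<open>v\<close> to be this derivative and \<open>R\<close> even makes the
  integrand a square. The variation can then vanish only if \<open>v\<close> does, and by periodicity this would make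
  \<open>cos \<theta>\<close> constant, which it is not, as \<open>\<theta>\<close> increases by \<open>pi\<close> from \<open>0\<close> to \<open>pi\<close>.\<close>

lemma undetectable_opening:
  fixes Q :: "(label \<times> int \<times> (nat \<Rightarrow> real)) set"
  assumes chain: "\<And>m. derivative_chain m \<phi>" and entire: "\<And>n. real_entire (\<phi> n)"
    and closed: "integral I (\<lambda>t. sin (\<phi> (-1) t)) = 0"
    and turn: "\<And>t. \<phi> (-1) (t + pi) = \<phi> (-1) t + pi"
    and l: "\<forall>j\<ge>1. analytic_on_I (l j)"
    and Q: "finite Q" and QC: "\<And>\<sigma> n c. (\<sigma>, n, c) \<in> Q \<Longrightarrow> c \<in> coeffs_C"
    and generic: "\<And>n c. c \<in> coeffs_C \<Longrightarrow> \<exists>t\<in>I. \<phi> n t \<noteq> combination l c t"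
  obtains k' where "analytic_on_I k'" "\<not> closed_curve k'"
    "\<And>q. q \<in> Q \<Longrightarrow> access b ns co l k' q = access b ns co l (\<phi> 0) q"
proof -
  define diff where "diff = (\<lambda>(\<sigma> :: label, n, c) t. \<phi> n t - combination l c t)"
  have an: "analytic_on_I (diff q)" for q
    using analytic_on_I_add[OF real_entire_analytic_on_I[OF entire]
        analytic_on_I_scale[OF analytic_on_I_combination[OF l], of "-1"]]
    by (cases q) (simp add: diff_def)
  have nz: "\<exists>t\<in>I. diff q t \<noteq> 0" if "q \<in> Q" for q
    using generic[OF QC] that by (cases q) (simp add: diff_def)
  define Z where "Z = {0, 2 * pi} \<union> (\<lambda>(\<sigma>, n, c). c 0) ` Q \<union> (\<Union>q\<in>Q. {t \<in> I. diff q t = 0})"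
  have "finite {t \<in> I. diff q t = 0}" if "q \<in> Q" for q
    using nz[OF that] analytic_on_I_finite_zeros[OF an] by blast
  then have Z: "finite Z" unfolding Z_def using Q by blast
  have ZI: "Z \<subseteq> I" using QC by (auto simp: Z_def coeffs_C_def)
  obtain \<omega> where \<omega>: "real_entire \<omega>" "\<And>t. \<omega> t = 0 \<longleftrightarrow> t \<in> Z" "\<And>t. t \<in> I \<Longrightarrow> \<bar>\<omega> t\<bar> \<le> 1"
    "\<And>t z. t \<in> I \<Longrightarrow> z \<in> Z \<Longrightarrow> \<bar>\<omega> t\<bar> \<le> \<bar>t - z\<bar>"
    using weight_product[OF Z ZI] by blast
  have "\<forall>\<^sub>F r in sequentially. \<forall>q\<in>Q. \<exists>B. \<forall>t\<in>I. \<bar>\<omega> t\<bar> ^ r \<le> B * \<bar>diff q t\<bar>"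
  proof (rule eventually_ball_finite[OF Q], rule ballI)
    fix q assume q: "q \<in> Q"
    obtain t0 where t0: "t0 \<in> I" "diff q t0 \<noteq> 0" using nz[OF q] by blast
    show "\<forall>\<^sub>F r in sequentially. \<exists>B. \<forall>t\<in>I. \<bar>\<omega> t\<bar> ^ r \<le> B * \<bar>diff q t\<bar>"
    proof (rule analytic_on_I_Lojasiewicz[OF an t0 \<omega>(3)])
      fix t z assume tz: "t \<in> I" "z \<in> I" "diff q z = 0"
      then have "z \<in> Z" using q by (auto simp: Z_def)
      then show "\<bar>\<omega> t\<bar> \<le> \<bar>t - z\<bar>" using \<omega>(4) tz by blast
    qed
  qed
  then obtain r where r: "\<And>q. q \<in> Q \<Longrightarrow> \<exists>B. \<forall>t\<in>I. \<bar>\<omega> t\<bar> ^ r \<le> B * \<bar>diff q t\<bar>"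
    unfolding eventually_sequentially by blast
  define M where "M = (\<Sum>(\<sigma>, n, c)\<in>Q. nat \<bar>n\<bar>)"
  have M: "\<bar>n\<bar> \<le> int M" if "(\<sigma>, n, c) \<in> Q" for \<sigma> n c
  proof -
    have "(\<lambda>(\<sigma>, n, c). nat \<bar>n\<bar>) (\<sigma>, n, c) \<le> M"
      unfolding M_def by (rule member_le_sum) (use that Q in auto)
    then show ?thesis by simp
  qed
  \<comment> \<open>Derivatives of \<open>w\<close> of order at most \<open>2 * M + 1\<close> occur; each keeps a power of \<open>\<omega>\<close> with an exponent that
    is positive and at least \<open>r\<close>. The factor \<open>2\<close> makes \<open>R\<close> even.\<close>
  define R where "R = 2 * (M + r + 1)"
  define u where "u t = cos (\<phi> (-1) t)" for t
  have u: "real_entire u" unfolding u_def[abs_def] by (intro real_entire_intros entire)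
  define v where "v = (deriv ^^ M) u"
  have v: "real_entire v" unfolding v_def using u by (rule real_entire_funpow_deriv)
  define w where "w t = \<omega> t ^ R * v t" for t
  have w: "real_entire w" unfolding w_def[abs_def] by (intro real_entire_intros \<omega> v)
  have D: "real_entire ((deriv ^^ j) w)" for j using w by (rule real_entire_funpow_deriv)
  have fact: "\<exists>h. real_entire h \<and> (\<forall>t. (deriv ^^ j) w t = \<omega> t ^ (R - j) * h t)" if "j \<le> R" for j
    using funpow_deriv_power_mult[OF \<omega>(1) v that] unfolding w_def[abs_def] by (auto simp: fun_eq_iff)
  have Dz: "(deriv ^^ j) w z = 0" if "j < R" "z \<in> Z" for j z
    using fact[of j] \<omega>(2)[of z] that by auto
  have ends: "0 \<in> Z" "2 * pi \<in> Z" by (auto simp: Z_def)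

  have A: "integral I (\<lambda>t. u t * (deriv ^^ M) w t) \<noteq> 0"
  proof
    assume 0: "integral I (\<lambda>t. u t * (deriv ^^ M) w t) = 0"
    have "integral I (\<lambda>t. u t * (deriv ^^ M) w t) = (-1) ^ M * integral I (\<lambda>t. v t * w t)"
      unfolding v_def using ends Dz by (intro integral_by_parts_iterated u w) (auto simp: R_def)
    with 0 have 0: "integral I (\<lambda>t. v t * w t) = 0" by simp
    have pos: "v t * w t = (\<omega> t ^ (M + r + 1) * v t)\<^sup>2" for t
      unfolding w_def R_def power_even_eq by (simp only: power2_eq_square mult_ac)
    have nonneg: "v t * w t \<ge> 0" for t unfolding pos by (rule zero_le_power2)
    have cont: "continuous_on I (\<lambda>t. v t * w t)"
      by (intro continuous_on_mult real_entire_continuous v w)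
    have "t \<in> Z \<union> {t \<in> I. v t = 0}" if t: "t \<in> I" for t
    proof -
      have "v t * w t = 0" using integral_eq_0_iff[OF cont] 0 t nonneg by simp
      then show ?thesis using \<omega>(2)[of t] t by (auto simp: w_def)
    qed
    then have "I \<subseteq> Z \<union> {t \<in> I. v t = 0}" by blast
    moreover have "infinite I" using pi_gt_zero by (simp add: infinite_Icc)
    ultimately have "infinite {t \<in> I. v t = 0}" using Z finite_subset by blast
    then have v0: "v t = 0" if "t \<in> I" for t
      using analytic_on_I_finite_zeros[OF real_entire_analytic_on_I[OF v] that] by blast
    have "(deriv ^^ 0) u pi = (deriv ^^ 0) u 0"
    proof (rule periodic_chain_constant[where n = M and c = 0])
      show "((deriv ^^ i) u has_real_derivative (deriv ^^ Suc i) u t) (at t)" for i t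
        using real_entire_deriv(2)[OF real_entire_funpow_deriv[OF u]] by simp
      show "(deriv ^^ 0) u (t + 2 * pi) = (deriv ^^ 0) u t" for t
      proof -
        have "\<phi> (-1) (t + 2 * pi) = \<phi> (-1) t + 2 * pi"
          using turn[of "t + pi"] turn[of t] by (simp add: algebra_simps)
        then show ?thesis by (simp add: u_def)
      qed
    qed (use v0 in \<open>auto simp: v_def\<close>)
    moreover have "\<phi> (-1) 0 = 0" using chain[of 1] unfolding derivative_chain_def by auto
    ultimately show False using turn[of 0] by (simp add: u_def)
  qed

  define \<psi> where "\<psi> n = (deriv ^^ nat (int (Suc M) + n)) w" for n
  have \<psi>': "(\<psi> n has_real_derivative \<psi> (n + 1) t) (at t)" if "n \<ge> - int (Suc M)" for n t
  proof -
    have "nat (int (Suc M) + (n + 1)) = Suc (nat (int (Suc M) + n))" using that by simp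
    then show ?thesis using real_entire_deriv(2)[OF D] unfolding \<psi>_def by simp
  qed
  have chain': "derivative_chain (Suc M) (\<lambda>n t. \<phi> n t + \<epsilon> * \<psi> n t)" for \<epsilon>
    unfolding derivative_chain_def
  proof (intro conjI allI impI)
    fix n assume n: "n \<ge> - int (Suc M)"
    have \<phi>: "(\<phi> n has_real_derivative \<phi> (n + 1) t) (at t)" "n < 0 \<longrightarrow> \<phi> n 0 = 0" for t
      using chain[of "Suc M"] n unfolding derivative_chain_def by auto
    show "((\<lambda>t. \<phi> n t + \<epsilon> * \<psi> n t) has_real_derivative \<phi> (n + 1) t + \<epsilon> * \<psi> (n + 1) t) (at t)" for t
      by (intro DERIV_add DERIV_cmult \<phi> \<psi>' n)
    show "\<phi> n 0 + \<epsilon> * \<psi> n 0 = 0" if "n < 0"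
      using \<phi>(2) that n ends by (auto simp: \<psi>_def R_def intro!: Dz)
  qed
  define k where "k \<epsilon> t = \<phi> 0 t + \<epsilon> * \<psi> 0 t" for \<epsilon> t
  have it: "iterated n (k \<epsilon>) t = \<phi> n t + \<epsilon> * \<psi> n t" if "n \<ge> - int (Suc M)" "t \<in> I" for n \<epsilon> t
    using iterated_chain[OF chain' that] unfolding k_def[abs_def] .
  have it0: "iterated n (\<phi> 0) t = \<phi> n t" if "n \<ge> - int (Suc M)" "t \<in> I" for n t
    using iterated_chain[OF chain that] .

  have "\<forall>\<^sub>F \<epsilon> in at_right 0. \<forall>q\<in>Q. access b ns co l (k \<epsilon>) q = access b ns co l (\<phi> 0) q"
  proof (rule eventually_ball_finite[OF Q], rule ballI)
    fix q assume q: "q \<in> Q"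
    obtain \<sigma> n c where qe: "q = (\<sigma>, n, c)" by (cases q) auto
    have n: "\<bar>n\<bar> \<le> int M" using M q qe by blast
    define j where "j = nat (int (Suc M) + n)"
    have j: "j < R" "r \<le> R - j" using n by (auto simp: j_def R_def)
    obtain h where h: "real_entire h" "\<And>t. \<psi> n t = \<omega> t ^ (R - j) * h t"
      using fact[of j] j(1) unfolding \<psi>_def j_def by auto
    obtain B where B: "\<And>t. t \<in> I \<Longrightarrow> \<bar>\<omega> t\<bar> ^ r \<le> B * \<bar>diff q t\<bar>" using r[OF q] by blast
    have "bounded (h ` I)"
      by (intro compact_imp_bounded compact_continuous_image real_entire_continuous h) simp
    then obtain H where H: "\<And>t. t \<in> I \<Longrightarrow> \<bar>h t\<bar> \<le> H"
      unfolding bounded_iff real_norm_def by blast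
    have "H \<ge> 0" using H[of 0] by simp
    have "\<bar>\<psi> n t\<bar> \<le> (B * H) * \<bar>\<phi> n t - combination l c t\<bar>" if t: "t \<in> I" for t
    proof -
      have "\<bar>\<psi> n t\<bar> = \<bar>\<omega> t\<bar> ^ (R - j) * \<bar>h t\<bar>" by (simp add: h(2) abs_mult power_abs)
      also have "\<dots> \<le> \<bar>\<omega> t\<bar> ^ r * H"
        using j(2) \<omega>(3)[OF t] H[OF t] by (intro mult_mono power_decreasing) auto
      also have "\<dots> \<le> (B * \<bar>diff q t\<bar>) * H"
        using B[OF t] \<open>H \<ge> 0\<close> by (rule mult_right_mono)
      finally show ?thesis by (simp add: diff_def qe mult_ac)
    qed
    then have "\<forall>\<^sub>F \<epsilon> in at_right 0. solutions (\<lambda>t. \<phi> n t + \<epsilon> * \<psi> n t) (combination l c)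
        = solutions (\<phi> n) (combination l c)"
      by (rule solutions_stable)
    then show "\<forall>\<^sub>F \<epsilon> in at_right 0. access b ns co l (k \<epsilon>) q = access b ns co l (\<phi> 0) q"
    proof eventually_elim
      case (elim \<epsilon>)
      have "c 0 \<in> Z" using q qe by (force simp: Z_def)
      then have "\<psi> n (c 0) = 0" using Dz[OF j(1)] by (simp add: \<psi>_def j_def)
      then show ?case
        unfolding qe using n elim QC q qe it it0
        by (intro access_cong[where f = "\<lambda>t. \<phi> n t + \<epsilon> * \<psi> n t" and f' = "\<phi> n"]) auto
    qed
  qed
  moreover have "\<forall>\<^sub>F \<epsilon> in at_right 0. \<not> closed_curve (k \<epsilon>)"
  proof -
    have c: "continuous_on I (\<phi> (-1))" "continuous_on I (\<psi> (-1))"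
      unfolding \<psi>_def by (intro real_entire_continuous entire D)+
    have "\<psi> (-1) = (deriv ^^ M) w" by (simp add: \<psi>_def)
    then have "\<forall>\<^sub>F \<epsilon> in at_right 0. integral I (\<lambda>t. sin (\<phi> (-1) t + \<epsilon> * \<psi> (-1) t)) \<noteq> 0"
      using A by (intro first_variation_sin c closed) (simp add: u_def)
    then show ?thesis
    proof eventually_elim
      case (elim \<epsilon>)
      have "integral {0..t} (k \<epsilon>) = \<phi> (-1) t + \<epsilon> * \<psi> (-1) t" if "t \<in> I" for t
        using it[of "-1" t \<epsilon>] that by (simp add: iterated_def antiderivative_def)
      moreover have "continuous_on I (\<lambda>t. \<phi> (-1) t + \<epsilon> * \<psi> (-1) t)"
        by (intro continuous_intros c)
      ultimately have "closed_curve (k \<epsilon>) \<longleftrightarrow>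
          integral I (\<lambda>t. cos (\<phi> (-1) t + \<epsilon> * \<psi> (-1) t)) = 0 \<and>
          integral I (\<lambda>t. sin (\<phi> (-1) t + \<epsilon> * \<psi> (-1) t)) = 0"
        by (rule closed_curve_iff)
      then show ?case using elim by simp
    qed
  qed
  ultimately have "\<forall>\<^sub>F \<epsilon> in at_right 0. (\<forall>q\<in>Q. access b ns co l (k \<epsilon>) q = access b ns co l (\<phi> 0) q)
      \<and> \<not> closed_curve (k \<epsilon>)"
    by (rule eventually_conj)
  then obtain \<epsilon> where \<epsilon>: "\<And>q. q \<in> Q \<Longrightarrow> access b ns co l (k \<epsilon>) q = access b ns co l (\<phi> 0) q"
    "\<not> closed_curve (k \<epsilon>)"
    using eventually_happens'[OF trivial_limit_at_right_real] by blast
  have "analytic_on_I (k \<epsilon>)"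
    unfolding k_def[abs_def] \<psi>_def
    by (intro real_entire_analytic_on_I real_entire_intros entire D)
  then show ?thesis using that \<epsilon> by blast
qed

section \<open>No procedure is correct\<close>

theorem theorem6p2:
  fixes blank no_sol coincide :: "'s::finite"
  assumes "distinct [blank, no_sol, coincide]"
  shows "\<not> (\<exists>(l :: nat \<Rightarrow> real \<Rightarrow> real)
             (M :: 's tape \<Rightarrow> label \<times> int \<times> (nat \<Rightarrow> real))
             (G :: 's tape \<times> label \<times> int \<times> 's tape \<Rightarrow> answer + 's tape).
            (\<forall>j\<ge>1. analytic_on_I (l j)) \<and>
            range M \<subseteq> UNIV \<times> UNIV \<times> coeffs_C \<and>
            correct_procedure blank no_sol coincide l M G)"
proof (intro notI, elim exE conjE)
  fix l M G
  assume l: "\<forall>j\<ge>1. analytic_on_I (l j)" and M: "range M \<subseteq> UNIV \<times> UNIV \<times> coeffs_C"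
    and correct: "correct_procedure blank no_sol coincide l M G"
  let ?H = "access blank no_sol coincide l"
  have "\<exists>\<phi>. \<phi> 0 = sym_curvature s \<and> (\<forall>n. real_entire (\<phi> n)) \<and> (\<forall>m. derivative_chain m \<phi>)" for s
    using real_entire_chain[OF real_entire_sym_curvature] by metis
  then obtain \<Phi> where \<Phi>: "\<And>s. \<Phi> s 0 = sym_curvature s" "\<And>s n. real_entire (\<Phi> s n)"
    "\<And>s m. derivative_chain m (\<Phi> s)" by metis
  obtain s where s: "\<And>n c. c \<in> coeffs_C \<Longrightarrow> \<exists>t\<in>I. \<Phi> s n t \<noteq> combination l c t"
    using generic_parameter[OF \<Phi>(3,1)] by blast
  have angle: "\<Phi> s (-1) = sym_angle s"
    by (rule sym_angle_chain[OF \<Phi>(3)[of 1] _ \<Phi>(1)]) simp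
  have cont: "continuous_on S (sym_angle s)" for S
    by (intro DERIV_continuous_on[OF DERIV_subset[OF sym_angle_deriv]]) auto
  have int: "integral I (\<lambda>t. cos (sym_angle s t)) = 0" "integral I (\<lambda>t. sin (sym_angle s t)) = 0"
    by (intro integral_antiperiodic continuous_intros cont; simp add: sym_angle_shift)+
  have "integral {0..t} (sym_curvature s) = sym_angle s t" if "t \<in> I" for t
    using iterated_chain[OF \<Phi>(3)[of 1], of "-1" t s] that
    by (simp add: iterated_def antiderivative_def \<Phi>(1) angle)
  then have closed: "closed_curve (sym_curvature s)"
    using closed_curve_iff[OF _ cont[of I], of "sym_curvature s"] int by simp
  obtain v where v: "run_output (?H (sym_curvature s)) M G (\<lambda>_. Inr blank) v" "v = YES"
    using correct closed real_entire_analytic_on_I[OF real_entire_sym_curvature]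
    unfolding correct_procedure_def by blast
  obtain Q where Q: "finite Q" "Q \<subseteq> range M"
    "\<And>H'. \<forall>q\<in>Q. H' q = ?H (sym_curvature s) q \<Longrightarrow> run_output H' M G (\<lambda>_. Inr blank) v"
    using run_output_finite_queries[OF v(1)] by blast
  obtain k where k: "analytic_on_I k" "\<not> closed_curve k"
    "\<And>q. q \<in> Q \<Longrightarrow> ?H k q = ?H (\<Phi> s 0) q"
  proof (rule undetectable_opening[OF \<Phi>(3)[of _ s] \<Phi>(2)[of s] _ _ l Q(1) _ s])
    show "integral I (\<lambda>t. sin (\<Phi> s (- 1) t)) = 0" unfolding angle by (rule int)
    show "\<Phi> s (- 1) (t + pi) = \<Phi> s (- 1) t + pi" for t
      unfolding angle by (rule sym_angle_shift)
    show "c \<in> coeffs_C" if "(\<sigma>, n, c) \<in> Q" for \<sigma> n c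
      using that Q(2) M by auto
  qed (use that in auto)
  have "run_output (?H k) M G (\<lambda>_. Inr blank) v" using Q(3) k(3) by (simp add: \<Phi>(1))
  moreover obtain v' where "run_output (?H k) M G (\<lambda>_. Inr blank) v'" "v' \<noteq> YES"
    using correct k unfolding correct_procedure_def by blast
  ultimately show False using run_output_unique v(2) by blast
qed

end
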